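(* Suppose $\kappa$ is a measurable cardinal. Then there is a transitive set $M \subseteq V_\kappa$ with $|M| = \kappa$ such that for every $\delta \leq \kappa$ there is an elementary embedding $j : M \to V_\kappa$ such that the set of cardinals of $M$ that are greater than $\operatorname{crit}(j)$ and fixed by $j$ has ordertype $\delta$.
   Context: $\operatorname{crit}(j)$ denotes the least ordinal moved by $j$. *)

theory Defs
  imports Main "HOL-Library.FuncSet" "HOL-Library.Countable_Set" "HOL-Library.Equipollence"
begin

(* A universe of sets is a type with a membership relation, x \<in> elts y, that satisfies the
   axioms of Zermelo set theory with Foundation, in second-order form (Separation for arbitrary
   HOL predicates); the cumulative hierarchy is added in the class below. Choice is inherited
   from HOL. *)
class zermelo =
  fixes elts :: "'a \<Rightarrow> 'a set"
  assumes extensionality: "elts x = elts y \<Longrightarrow> x = y"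
    and foundation: "wf {(x, y). x \<in> elts y}"
    and separation: "A \<subseteq> elts x \<Longrightarrow> \<exists>z. elts z = A"
    and pairing: "\<exists>z. elts z = {x, y}"
    and union: "\<exists>z. elts z = (\<Union>y\<in>elts x. elts y)"
    and power_set: "\<exists>z. elts z = {y. elts y \<subseteq> elts x}"
    and infinity: "\<exists>z. (\<exists>e\<in>elts z. elts e = {}) \<and>
                       (\<forall>u\<in>elts z. \<exists>s\<in>elts z. elts s = insert u (elts u))"
begin

definition transitive :: "'a \<Rightarrow> bool" where
  "transitive x \<longleftrightarrow> (\<forall>y\<in>elts x. elts y \<subseteq> elts x)"

definition Ord :: "'a \<Rightarrow> bool" where
  "Ord \<alpha> \<longleftrightarrow> transitive \<alpha> \<and> (\<forall>x\<in>elts \<alpha>. transitive x)"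

function Vlevel :: "'a \<Rightarrow> 'a set" where
  "Vlevel \<alpha> = (\<Union>\<beta>\<in>elts \<alpha>. {x. elts x \<subseteq> Vlevel \<beta>})"
  by pat_completeness auto
termination
  by (relation "{(x, y). x \<in> elts y}") (auto simp: foundation)

end

(* Full Replacement is deliberately not assumed. Models of these axioms include the universes of
   second-order ZFC and also every V_\<lambda> with \<lambda> > \<omega> a limit ordinal, so a theorem about \<kappa> proved here
   does not presuppose an inaccessible cardinal above \<kappa>. *)
class set_universe = zermelo +
  assumes levels: "Ord \<alpha> \<Longrightarrow> \<exists>v. elts v = Vlevel \<alpha>"

definition Card :: "'a::set_universe \<Rightarrow> bool" where
  "Card \<kappa> \<longleftrightarrow> Ord \<kappa> \<and> (\<forall>\<beta>\<in>elts \<kappa>. \<not> elts \<beta> \<approx> elts \<kappa>)"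

definition ultrafilter_on :: "'b set \<Rightarrow> 'b set set \<Rightarrow> bool" where
  "ultrafilter_on S U \<longleftrightarrow>
     U \<subseteq> Pow S \<and> S \<in> U \<and> {} \<notin> U \<and>
     (\<forall>A\<in>U. \<forall>B. A \<subseteq> B \<and> B \<subseteq> S \<longrightarrow> B \<in> U) \<and>
     (\<forall>A\<in>U. \<forall>B\<in>U. A \<inter> B \<in> U) \<and>
     (\<forall>A. A \<subseteq> S \<longrightarrow> A \<in> U \<or> S - A \<in> U)"

definition measurable_cardinal :: "'a::set_universe \<Rightarrow> bool" where
  "measurable_cardinal \<kappa> \<longleftrightarrow>
     Card \<kappa> \<and> uncountable (elts \<kappa>) \<and>
     (\<exists>U. ultrafilter_on (elts \<kappa>) U \<and>
          (\<forall>\<xi>\<in>elts \<kappa>. {\<xi>} \<notin> U) \<and>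
          (\<forall>F. F \<subseteq> U \<and> F \<noteq> {} \<and> F \<prec> elts \<kappa> \<longrightarrow> \<Inter>F \<in> U))"

(* First-order formulas in the language of set theory; variables are natural numbers. *)
datatype fm = Mem nat nat | Equal nat nat | Neg fm | Conj fm fm | Exists nat fm

primrec sat :: "'a::set_universe set \<Rightarrow> (nat \<Rightarrow> 'a) \<Rightarrow> fm \<Rightarrow> bool" where
  "sat A s (Mem i k) \<longleftrightarrow> s i \<in> elts (s k)"
| "sat A s (Equal i k) \<longleftrightarrow> s i = s k"
| "sat A s (Neg \<phi>) \<longleftrightarrow> \<not> sat A s \<phi>"
| "sat A s (Conj \<phi> \<psi>) \<longleftrightarrow> sat A s \<phi> \<and> sat A s \<psi>"
| "sat A s (Exists i \<phi>) \<longleftrightarrow> (\<exists>a\<in>A. sat A (s(i := a)) \<phi>)"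

(* For sets A and B of the universe, the restriction of j to A is itself a set of the universe,
   by Separation, so HOL functions can be used here. *)
definition elementary_embedding :: "('a::set_universe \<Rightarrow> 'a) \<Rightarrow> 'a set \<Rightarrow> 'a set \<Rightarrow> bool" where
  "elementary_embedding j A B \<longleftrightarrow>
     j \<in> A \<rightarrow> B \<and> (\<forall>\<phi> s. range s \<subseteq> A \<longrightarrow> (sat A s \<phi> \<longleftrightarrow> sat B (j \<circ> s) \<phi>))"

(* c = crit(j); in particular j moves some ordinal of its domain A. *)
definition is_crit :: "('a::set_universe \<Rightarrow> 'a) \<Rightarrow> 'a set \<Rightarrow> 'a \<Rightarrow> bool" where
  "is_crit j A c \<longleftrightarrow>
     c \<in> A \<and> Ord c \<and> j c \<noteq> c \<and>
     (\<forall>\<beta>\<in>A. Ord \<beta> \<and> j \<beta> \<noteq> \<beta> \<longrightarrow> \<beta> = c \<or> c \<in> elts \<beta>)"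

(* The suffix _in marks relativization: foo_in A x means that the structure (A, \<in>) satisfies
   "foo x", every quantifier being restricted to A. Pairs are Kuratowski pairs. *)
definition ord_in :: "'a::set_universe set \<Rightarrow> 'a \<Rightarrow> bool" where
  "ord_in A \<alpha> \<longleftrightarrow>
     (\<forall>x\<in>A. x \<in> elts \<alpha> \<longrightarrow> (\<forall>y\<in>A. y \<in> elts x \<longrightarrow> y \<in> elts \<alpha>)) \<and>
     (\<forall>x\<in>A. x \<in> elts \<alpha> \<longrightarrow>
        (\<forall>y\<in>A. y \<in> elts x \<longrightarrow> (\<forall>z\<in>A. z \<in> elts y \<longrightarrow> z \<in> elts x)))"

definition upair_in :: "'a::set_universe set \<Rightarrow> 'a \<Rightarrow> 'a \<Rightarrow> 'a \<Rightarrow> bool" where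
  "upair_in A x y p \<longleftrightarrow> (\<forall>z\<in>A. z \<in> elts p \<longleftrightarrow> z = x \<or> z = y)"

definition pair_in :: "'a::set_universe set \<Rightarrow> 'a \<Rightarrow> 'a \<Rightarrow> 'a \<Rightarrow> bool" where
  "pair_in A x y p \<longleftrightarrow>
     (\<exists>u\<in>A. \<exists>v\<in>A. upair_in A x x u \<and> upair_in A x y v \<and> upair_in A u v p)"

definition bij_in :: "'a::set_universe set \<Rightarrow> 'a \<Rightarrow> 'a \<Rightarrow> 'a \<Rightarrow> bool" where
  "bij_in A f \<alpha> \<beta> \<longleftrightarrow>
     (\<forall>p\<in>A. p \<in> elts f \<longrightarrow>
        (\<exists>x\<in>A. \<exists>y\<in>A. x \<in> elts \<alpha> \<and> y \<in> elts \<beta> \<and> pair_in A x y p)) \<and>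
     (\<forall>x\<in>A. x \<in> elts \<alpha> \<longrightarrow>
        (\<exists>!y. y \<in> A \<and> y \<in> elts \<beta> \<and> (\<exists>p\<in>A. p \<in> elts f \<and> pair_in A x y p))) \<and>
     (\<forall>y\<in>A. y \<in> elts \<beta> \<longrightarrow>
        (\<exists>!x. x \<in> A \<and> x \<in> elts \<alpha> \<and> (\<exists>p\<in>A. p \<in> elts f \<and> pair_in A x y p)))"

definition card_in :: "'a::set_universe set \<Rightarrow> 'a \<Rightarrow> bool" where
  "card_in A \<mu> \<longleftrightarrow>
     ord_in A \<mu> \<and> \<not> (\<exists>\<beta>\<in>A. \<beta> \<in> elts \<mu> \<and> (\<exists>f\<in>A. bij_in A f \<beta> \<mu>))"

(* S is a set of ordinals, ordered by membership; \<delta> is an ordinal. *)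
definition has_ordertype :: "'a::set_universe set \<Rightarrow> 'a \<Rightarrow> bool" where
  "has_ordertype S \<delta> \<longleftrightarrow>
     (\<exists>f. bij_betw f S (elts \<delta>) \<and> (\<forall>x\<in>S. \<forall>y\<in>S. x \<in> elts y \<longleftrightarrow> f x \<in> elts (f y)))"

end

theory Submission
  imports Defs
begin

text \<open>
  Let \<open>W\<close> be a normal ultrafilter on \<open>\<kappa>\<close>, and let \<open>D \<in> W\<close> be a set of cardinals that is indiscernible for
  \<open>V\<^sub>\<kappa>\<close> with Skolem functions, with increasing enumeration \<open>d\<close>. Let \<open>M\<close> be the transitive collapse,
  by \<open>\<pi>\<close>, of the Skolem hull of \<open>D\<close>. Every increasing \<open>\<sigma> : \<kappa> \<rightarrow> D\<close> induces an elementary embedding of \<open>M\<close> into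
  \<open>V\<^sub>\<kappa>\<close> that sends \<open>\<pi> (d \<beta>)\<close> to \<open>\<sigma> \<beta>\<close>. By normality, a term whose value lies below \<open>d \<beta>\<close> does not depend on the
  indiscernibles from \<open>d \<beta>\<close> on. Hence \<open>\<beta> \<mapsto> \<pi> (d \<beta>)\<close> is continuous at limits and \<open>\<pi> (d \<beta>)\<close> has at
  most \<open>|\<beta>| + \<omega>\<close> elements, so \<open>\<pi> (d \<theta>) = \<theta>\<close> for every uncountable cardinal \<open>\<theta> < \<kappa>\<close>.

  A cardinal of \<open>M\<close> fixed by an elementary embedding into \<open>V\<^sub>\<kappa>\<close> is a cardinal of \<open>V\<^sub>\<kappa>\<close>, hence a true
  cardinal; if it is above the critical point it is moreover uncountable, so it is some \<open>\<theta>\<close> with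
  \<open>\<sigma> \<theta> = \<theta>\<close>. Since \<open>W\<close> is normal, \<open>W\<close>-many \<open>\<alpha> \<in> D\<close> satisfy \<open>d \<alpha> = \<alpha>\<close>, and for a set \<open>S\<close> of (suitably closed)
  such \<open>\<alpha>\<close> of ordertype \<open>\<delta>\<close> one can choose \<open>\<sigma>\<close> with \<open>\<sigma> \<alpha> = \<alpha>\<close> on \<open>S\<close> and \<open>\<sigma> \<beta> > \<beta>\<close> elsewhere.
\<close>

section \<open>Ordinals and the cumulative hierarchy\<close>

lemma elts_induct [case_names step]:
  fixes x :: "'v::set_universe"
  assumes "\<And>x. (\<And>y. y \<in> elts x \<Longrightarrow> P y) \<Longrightarrow> P x"
  shows "P x"
  using foundation by (rule wf_induct_rule) (use assms in auto)

lemma mem_not_refl [simp]: "(x::'v::set_universe) \<notin> elts x"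
  by (induction x rule: elts_induct) blast

lemma mem_asym: "x \<in> elts y \<Longrightarrow> y \<notin> elts (x::'v::set_universe)"
proof (induction x arbitrary: y rule: elts_induct)
  case (step x)
  then show ?case by blast
qed

lemma Ord_in_Ord: "Ord \<alpha> \<Longrightarrow> \<beta> \<in> elts \<alpha> \<Longrightarrow> Ord (\<beta>::'v::set_universe)"
  unfolding Ord_def transitive_def by blast

lemma Ord_trans: "Ord \<gamma> \<Longrightarrow> \<alpha> \<in> elts \<beta> \<Longrightarrow> \<beta> \<in> elts \<gamma> \<Longrightarrow> \<alpha> \<in> elts (\<gamma>::'v::set_universe)"
  unfolding Ord_def transitive_def by blast

lemma Ord_linear:
  "Ord \<alpha> \<Longrightarrow> Ord \<beta> \<Longrightarrow> \<alpha> \<in> elts \<beta> \<or> \<alpha> = \<beta> \<or> \<beta> \<in> elts (\<alpha>::'v::set_universe)"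
proof (induction \<alpha> arbitrary: \<beta> rule: elts_induct)
  case (step \<alpha>)
  note outer = step
  show ?case using outer(3)
  proof (induction \<beta> rule: elts_induct)
    case (step \<beta>)
    show ?case
    proof (rule ccontr)
      assume neg: "\<not> ?case"
      have "elts \<alpha> \<subseteq> elts \<beta>"
        using outer(1) Ord_in_Ord[OF outer(2)] step(2) neg Ord_trans[OF outer(2)] by blast
      moreover have "elts \<beta> \<subseteq> elts \<alpha>"
        using step(1) Ord_in_Ord[OF step(2)] neg Ord_trans[OF step(2)] by blast
      ultimately show False using neg extensionality by blast
    qed
  qed
qed

lemma Ord_subset:
  "Ord \<alpha> \<Longrightarrow> Ord \<beta> \<Longrightarrow> elts \<alpha> \<subseteq> elts \<beta> \<Longrightarrow> \<alpha> = \<beta> \<or> \<alpha> \<in> elts (\<beta>::'v::set_universe)"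
  using Ord_linear mem_not_refl by blast

lemma Ord_least:
  fixes \<kappa> :: "'v::set_universe"
  assumes "Ord \<kappa>" "x \<in> elts \<kappa>" "P x"
  obtains y where "y \<in> elts \<kappa>" "P y" "\<And>z. z \<in> elts \<kappa> \<Longrightarrow> P z \<Longrightarrow> z = y \<or> y \<in> elts z"
proof -
  have "x \<in> {x \<in> elts \<kappa>. P x}" using assms by simp
  from foundation[unfolded wf_eq_minimal, rule_format, OF this]
  obtain y where y: "y \<in> {x \<in> elts \<kappa>. P x}"
    "\<And>z. z \<in> elts y \<Longrightarrow> z \<notin> {x \<in> elts \<kappa>. P x}"
    by auto
  show thesis
  proof (rule that[of y])
    fix z assume z: "z \<in> elts \<kappa>" "P z"
    then have "z \<notin> elts y" using y(2)[of z] by auto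
    then show "z = y \<or> y \<in> elts z"
      using Ord_linear[of z y] Ord_in_Ord[OF assms(1)] z y(1) by auto
  qed (use y(1) in auto)
qed

section \<open>Ordinals inside the cumulative hierarchy\<close>

declare Vlevel.simps [simp del]

lemma Vlevel_iff: "x \<in> Vlevel \<alpha> \<longleftrightarrow> (\<exists>\<beta>\<in>elts \<alpha>. elts x \<subseteq> Vlevel \<beta>)"
  by (subst Vlevel.simps) simp

lemma Vlevel_mono: "Ord \<alpha> \<Longrightarrow> \<beta> \<in> elts \<alpha> \<Longrightarrow> Vlevel \<beta> \<subseteq> Vlevel (\<alpha>::'v::set_universe)"
  using Vlevel_iff Ord_trans by blast

lemma Vlevel_subset: "Ord \<alpha> \<Longrightarrow> x \<in> Vlevel \<alpha> \<Longrightarrow> elts x \<subseteq> Vlevel (\<alpha>::'v::set_universe)"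
  using Vlevel_mono Vlevel_iff by blast

lemma Ord_subset_Vlevel: "Ord \<alpha> \<Longrightarrow> elts \<alpha> \<subseteq> Vlevel (\<alpha>::'v::set_universe)"
proof (induction \<alpha> rule: elts_induct)
  case (step \<alpha>)
  then show ?case using Ord_in_Ord Vlevel_iff by blast
qed

lemma Ord_Vlevel_subset:
  "Ord \<alpha> \<Longrightarrow> Ord \<beta> \<Longrightarrow> elts \<alpha> \<subseteq> Vlevel \<beta> \<Longrightarrow> elts \<alpha> \<subseteq> elts (\<beta>::'v::set_universe)"
proof (induction \<beta> arbitrary: \<alpha> rule: elts_induct)
  case (step \<beta>)
  show ?case
  proof
    fix \<gamma> assume g: "\<gamma> \<in> elts \<alpha>"
    then obtain \<delta> where d: "\<delta> \<in> elts \<beta>" "elts \<gamma> \<subseteq> Vlevel \<delta>" using step Vlevel_iff by blast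
    have "Ord \<gamma>" "Ord \<delta>" using g d step Ord_in_Ord by blast+
    then have "\<gamma> = \<delta> \<or> \<gamma> \<in> elts \<delta>" using step(1)[OF d(1), of \<gamma>] d(2) Ord_subset by blast
    then show "\<gamma> \<in> elts \<beta>" using d Ord_trans[OF step(3)] by blast
  qed
qed

text \<open>An ordinal is its own rank, so the level at \<beta> has no ordinals outside \<beta>;
  later this puts the ordinals of \<open>M\<close> below \<kappa>.\<close>

lemma Ord_in_Vlevel:
  assumes "Ord \<alpha>" "Ord \<beta>" "\<alpha> \<in> Vlevel \<beta>" shows "\<alpha> \<in> elts (\<beta>::'v::set_universe)"
proof -
  obtain \<gamma> where g: "\<gamma> \<in> elts \<beta>" "elts \<alpha> \<subseteq> Vlevel \<gamma>" using assms Vlevel_iff by blast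
  have "Ord \<gamma>" using g assms Ord_in_Ord by blast
  then have "\<alpha> = \<gamma> \<or> \<alpha> \<in> elts \<gamma>" using g Ord_Vlevel_subset Ord_subset assms(1) by blast
  then show ?thesis using g Ord_trans[OF assms(2)] by blast
qed

section \<open>Cardinals and comparison of sizes\<close>

lemma Card_imp_Ord: "Card \<alpha> \<Longrightarrow> Ord \<alpha>"
  by (simp add: Card_def)

lemma Card_lesspoll:
  assumes "Card \<alpha>" "\<beta> \<in> elts \<alpha>" shows "elts \<beta> \<prec> elts (\<alpha>::'v::set_universe)"
proof -
  have "elts \<beta> \<subseteq> elts \<alpha>" using assms Ord_trans Card_imp_Ord by blast
  then show ?thesis using assms subset_imp_lepoll lepoll_iff_leqpoll Card_def by blast
qed

lemma Card_memI:
  assumes "Card \<theta>" "Ord \<beta>" "elts \<beta> \<prec> elts \<theta>" shows "\<beta> \<in> elts (\<theta>::'v::set_universe)"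
proof -
  have "\<not> elts \<theta> \<subseteq> elts \<beta>" using assms(3)
    by (meson lesspoll_not_refl lesspoll_trans2 subset_imp_lepoll)
  then show ?thesis using Ord_linear[OF assms(2) Card_imp_Ord[OF assms(1)]] Ord_trans[OF assms(2)] by blast
qed

lemma countable_lesspoll_uncountable:
  assumes "countable I" "uncountable B" shows "I \<prec> B"
proof -
  have "infinite B" using assms(2) uncountable_infinite by blast
  then have "(UNIV::nat set) \<lesssim> B" using infinite_le_lepoll by blast
  moreover have "I \<lesssim> (UNIV::nat set)" using assms(1) by (auto simp: countable_def lepoll_def)
  ultimately have "I \<lesssim> B" using lepoll_trans by blast
  moreover have "\<not> I \<approx> B" using assms countable_eqpoll eqpoll_sym by blast
  ultimately show ?thesis using lepoll_iff_leqpoll by blast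
qed

lemma countable_Ord_memI:
  assumes "Ord \<alpha>" "Ord \<beta>" "countable (elts \<alpha>)" "uncountable (elts \<beta>)"
  shows "\<alpha> \<in> elts (\<beta>::'v::set_universe)"
proof -
  have "\<not> elts \<beta> \<subseteq> elts \<alpha>" using assms(3,4) countable_subset by blast
  then show ?thesis using Ord_linear[OF assms(1,2)] Ord_trans[OF assms(1)] by blast
qed

text \<open>Applied to the finitely many variables of a term below a limit and, by contraposition,
  to see that nonzero finite ordinals are successors.\<close>

lemma Ord_finite_bound:
  assumes \<theta>: "Ord \<theta>" "elts \<theta> \<noteq> {}" "\<And>\<xi>. \<xi> \<in> elts \<theta> \<Longrightarrow> \<exists>\<eta>\<in>elts \<theta>. \<xi> \<in> elts \<eta>"
    and "finite X" "X \<subseteq> elts (\<theta>::'v::set_universe)"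
  shows "\<exists>\<gamma>\<in>elts \<theta>. X \<subseteq> elts \<gamma>"
  using assms(4,5)
proof (induction X rule: finite_induct)
  case (insert x X)
  then obtain \<gamma> where \<gamma>: "\<gamma> \<in> elts \<theta>" "X \<subseteq> elts \<gamma>" by auto
  obtain \<xi> where \<xi>: "\<xi> \<in> elts \<theta>" "x \<in> elts \<xi>" using \<theta>(3) insert.prems by blast
  have O: "Ord \<gamma>" "Ord \<xi>" using \<gamma> \<xi> Ord_in_Ord \<theta>(1) by blast+
  then consider "\<gamma> \<in> elts \<xi>" | "\<gamma> = \<xi>" | "\<xi> \<in> elts \<gamma>" using Ord_linear by blast
  then show ?case using \<gamma> \<xi> Ord_trans O by cases blast+
qed (use \<theta>(2) in auto)

lemma Ord_predecessor:
  assumes "Ord \<theta>" "\<xi> \<in> elts \<theta>" "\<And>\<eta>. \<eta> \<in> elts \<theta> \<Longrightarrow> \<xi> \<notin> elts \<eta>"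
  shows "elts \<theta> = insert \<xi> (elts (\<xi>::'v::set_universe))"
proof (intro equalityI subsetI)
  fix \<eta> assume "\<eta> \<in> elts \<theta>"
  then show "\<eta> \<in> insert \<xi> (elts \<xi>)"
    using Ord_linear[of \<xi> \<eta>] Ord_in_Ord[OF assms(1)] assms(2,3) by auto
next
  fix \<eta> assume "\<eta> \<in> insert \<xi> (elts \<xi>)"
  then show "\<eta> \<in> elts \<theta>" using assms(2) Ord_trans[OF assms(1)] by auto
qed

text \<open>If no element were largest, the finite set \<open>elts c\<close> would be bounded by one
  of its own members, which would then belong to itself.\<close>

lemma finite_Ord_predecessor:
  assumes "Ord c" "finite (elts c)" "elts c \<noteq> {}"
  obtains b where "b \<in> elts c" "elts c = insert b (elts (b::'v::set_universe))"
proof -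
  have "\<exists>b. b \<in> elts c \<and> (\<forall>y\<in>elts c. b \<notin> elts y)"
  proof (rule ccontr)
    assume "\<not> ?thesis"
    then have "\<And>\<xi>. \<xi> \<in> elts c \<Longrightarrow> \<exists>\<eta>\<in>elts c. \<xi> \<in> elts \<eta>" by blast
    from Ord_finite_bound[OF assms(1,3) this assms(2) subset_refl] show False by auto
  qed
  then obtain b where b: "b \<in> elts c" "\<forall>y\<in>elts c. b \<notin> elts y" by (elim exE conjE)
  have "elts c = insert b (elts b)" by (rule Ord_predecessor[OF assms(1) b(1)]) (use b(2) in simp)
  with b(1) show thesis by (rule that)
qed

text \<open>A largest element \<xi> would give \<theta> = \<xi> \<union> {\<xi>}, and one extra
  point does not change the size of an infinite set.\<close>

lemma Card_limit:
  assumes "Card \<theta>" "infinite (elts \<theta>)" "\<xi> \<in> elts \<theta>"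
  shows "\<exists>\<eta>\<in>elts \<theta>. \<xi> \<in> elts (\<eta>::'v::set_universe)"
proof (rule ccontr)
  assume "\<not> ?thesis"
  then have eq: "elts \<theta> = insert \<xi> (elts \<xi>)"
    using Ord_predecessor[OF Card_imp_Ord[OF assms(1)] assms(3)] by blast
  then have "infinite (elts \<xi>)" using assms(2) by simp
  then have "elts \<xi> \<approx> elts \<theta>" using infinite_insert_eqpoll eqpoll_sym eq by metis
  then show False using assms(1,3) unfolding Card_def by blast
qed

section \<open>Increasing maps on ordinals\<close>

definition increasing_on :: "'v set \<Rightarrow> ('v::set_universe \<Rightarrow> 'v) \<Rightarrow> bool" where
  "increasing_on X \<sigma> \<longleftrightarrow> (\<forall>x\<in>X. \<forall>y\<in>X. x \<in> elts y \<longrightarrow> \<sigma> x \<in> elts (\<sigma> y))"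

lemma increasing_on_subset: "increasing_on X \<sigma> \<Longrightarrow> Y \<subseteq> X \<Longrightarrow> increasing_on Y \<sigma>"
  unfolding increasing_on_def by blast

lemma increasing_on_iff:
  assumes "increasing_on X \<sigma>" "\<And>x. x \<in> X \<Longrightarrow> Ord x" "x \<in> X" "y \<in> X"
  shows "\<sigma> x \<in> elts (\<sigma> y) \<longleftrightarrow> x \<in> elts y"
proof
  assume a: "\<sigma> x \<in> elts (\<sigma> y)"
  then have "x \<noteq> y" "\<not> y \<in> elts x"
    using assms mem_asym[OF a] unfolding increasing_on_def by auto
  then show "x \<in> elts y" using Ord_linear assms by blast
qed (use assms in \<open>simp add: increasing_on_def\<close>)

text \<open>If f \<alpha> < \<alpha>, then f (f \<alpha>) < f \<alpha>, so f \<alpha> is a smaller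
  counterexample.\<close>

lemma increasing_on_ge:
  assumes "Ord \<kappa>" "increasing_on (elts \<kappa>) f" "\<And>x. x \<in> elts \<kappa> \<Longrightarrow> Ord (f x)" "\<alpha> \<in> elts \<kappa>"
  shows "f \<alpha> = \<alpha> \<or> \<alpha> \<in> elts (f (\<alpha>::'v::set_universe))"
  using assms(4)
proof (induction \<alpha> rule: elts_induct)
  case (step \<alpha>)
  have "f \<alpha> \<notin> elts \<alpha>"
  proof
    assume a: "f \<alpha> \<in> elts \<alpha>"
    then have k: "f \<alpha> \<in> elts \<kappa>" using step(2) Ord_trans[OF assms(1)] by blast
    have "f (f \<alpha>) \<in> elts (f \<alpha>)" using a k step(2) assms(2) unfolding increasing_on_def by blast
    then show False using step(1)[OF a k] mem_asym by auto
  qed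
  then show ?case using Ord_linear[OF assms(3)[OF step(2)] Ord_in_Ord[OF assms(1) step(2)]] by blast
qed

lemma increasing_on_inj:
  assumes "increasing_on X f" "\<And>x. x \<in> X \<Longrightarrow> Ord (x::'v::set_universe)" shows "inj_on f X"
proof (rule inj_onI)
  fix x y assume "x \<in> X" "y \<in> X" "f x = f y"
  then show "x = y"
    using increasing_on_iff[OF assms, of x y] increasing_on_iff[OF assms, of y x] Ord_linear[of x y] assms(2) by auto
qed

text \<open>Each finite power of an infinite set injects into it; recording the length, coded as an
  element of \<open>A\<close>, combines these into one injection into A \<times> A.\<close>

lemma lists_lepoll:
  assumes "infinite A" shows "lists A \<lesssim> A"
proof -
  have n: "{xs. length xs = n \<and> set xs \<subseteq> A} \<lesssim> A" for n
  proof (induction n)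
    case 0
    have "{xs. length xs = 0 \<and> set xs \<subseteq> A} = {[]}" by auto
    then show ?case using assms finite_lepoll_infinite by (metis finite.emptyI finite_insert)
  next
    case (Suc n)
    have "{xs. length xs = Suc n \<and> set xs \<subseteq> A} \<subseteq> (\<lambda>(x, xs). x # xs) ` (A \<times> {xs. length xs = n \<and> set xs \<subseteq> A})"
      by (auto simp: length_Suc_conv image_iff)
    then have "{xs. length xs = Suc n \<and> set xs \<subseteq> A} \<lesssim> A \<times> {xs. length xs = n \<and> set xs \<subseteq> A}"
      by (rule subset_image_lepoll)
    also have "\<dots> \<lesssim> A \<times> A" using Suc by (intro times_lepoll_mono) auto
    also have "\<dots> \<approx> A" using assms
      by (simp add: eqpoll_iff_card_of_ordIso card_of_Times_same_infinite)
    finally show ?case .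
  qed
  define f where "f n = (SOME f. inj_on f {xs. length xs = n \<and> set xs \<subseteq> A} \<and>
    f ` {xs. length xs = n \<and> set xs \<subseteq> A} \<subseteq> A)" for n
  have f: "inj_on (f n) {xs. length xs = n \<and> set xs \<subseteq> A}"
    "f n ` {xs. length xs = n \<and> set xs \<subseteq> A} \<subseteq> A" for n
    using someI_ex[OF n[of n, unfolded lepoll_def]] unfolding f_def by auto
  obtain g where g: "inj g" "range (g::nat \<Rightarrow> 'a) \<subseteq> A"
    using assms by (meson infinite_countable_subset)
  have "lists A \<lesssim> A \<times> A"
    unfolding lepoll_def
  proof (intro exI conjI)
    let ?h = "\<lambda>xs. (g (length xs), f (length xs) xs)"
    show "inj_on ?h (lists A)"
    proof (rule inj_onI)
      fix xs ys assume a: "xs \<in> lists A" "ys \<in> lists A" "?h xs = ?h ys"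
      then have "length xs = length ys" using g(1) by (auto dest: injD)
      then show "xs = ys" using a by (intro inj_onD[OF f(1)[of "length xs"]]) (auto simp: lists_eq_set)
    qed
    have "?h xs \<in> A \<times> A" if "xs \<in> lists A" for xs
      using that f(2)[of "length xs"] g(2) by (auto simp: lists_eq_set)
    then show "?h ` lists A \<subseteq> A \<times> A" by blast
  qed
  also have "A \<times> A \<approx> A" using assms
    by (simp add: eqpoll_iff_card_of_ordIso card_of_Times_same_infinite)
  finally show ?thesis .
qed

lemma times_countable_lepoll:
  assumes "infinite A" "countable C" shows "C \<times> A \<lesssim> A"
proof -
  have "C \<lesssim> (UNIV::nat set)" using assms(2) by (auto simp: countable_def lepoll_def)
  also have "\<dots> \<lesssim> A" using assms infinite_le_lepoll by blast
  finally have "C \<times> A \<lesssim> A \<times> A" by (intro times_lepoll_mono) auto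
  also have "A \<times> A \<approx> A" using assms
    by (simp add: eqpoll_iff_card_of_ordIso card_of_Times_same_infinite)
  finally show ?thesis .
qed

lemma Un_countable_lepoll:
  assumes "infinite A" "countable C" shows "A \<union> C \<lesssim> A"
proof -
  have "A \<union> C \<lesssim> A <+> C"
    by (rule subset_image_lepoll[of _ "case_sum id id"]) (force simp: image_iff)
  also have "A <+> C \<lesssim> A"
  proof -
    have "C \<lesssim> (UNIV::nat set)" using assms(2) by (auto simp: countable_def lepoll_def)
    also have "\<dots> \<lesssim> A" using assms infinite_le_lepoll by blast
    finally have "A <+> C \<lesssim> A <+> A" by (intro sum_lepoll_mono) auto
    also have "A <+> A \<approx> A" using assms
      by (simp add: eqpoll_iff_card_of_ordIso card_of_Plus_infinite1 card_of_mono1)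
    finally show ?thesis .
  qed
  finally show ?thesis .
qed

section \<open>Complete ultrafilters and normality\<close>

text \<open>The ultrafilter is a parameter because there are two of them: the one given by
  measurability and the normal one derived from it.\<close>

locale complete_ultrafilter =
  fixes \<kappa> :: "'v::set_universe" and W :: "'v set set"
  assumes Card_kappa: "Card \<kappa>"
    and uncountable_kappa: "uncountable (elts \<kappa>)"
    and ultrafilter: "ultrafilter_on (elts \<kappa>) W"
    and nonprincipal: "\<xi> \<in> elts \<kappa> \<Longrightarrow> {\<xi>} \<notin> W"
    and complete: "F \<subseteq> W \<Longrightarrow> F \<noteq> {} \<Longrightarrow> F \<prec> elts \<kappa> \<Longrightarrow> \<Inter>F \<in> W"
begin

lemma Ord_kappa: "Ord \<kappa>"
  using Card_kappa by (rule Card_imp_Ord)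

lemma Ord_in_kappa: "\<xi> \<in> elts \<kappa> \<Longrightarrow> Ord \<xi>"
  using Ord_kappa Ord_in_Ord by blast

lemma below_kappa: "\<xi> \<in> elts \<kappa> \<Longrightarrow> \<eta> \<in> elts \<xi> \<Longrightarrow> \<eta> \<in> elts \<kappa>"
  using Ord_kappa Ord_trans by blast

lemma W_subset: "X \<in> W \<Longrightarrow> X \<subseteq> elts \<kappa>"
  using ultrafilter unfolding ultrafilter_on_def by blast

lemma W_top: "elts \<kappa> \<in> W"
  using ultrafilter unfolding ultrafilter_on_def by blast

lemma W_mono: "X \<in> W \<Longrightarrow> X \<subseteq> Y \<Longrightarrow> Y \<subseteq> elts \<kappa> \<Longrightarrow> Y \<in> W"
  using ultrafilter unfolding ultrafilter_on_def by meson

lemma W_Int: "X \<in> W \<Longrightarrow> Y \<in> W \<Longrightarrow> X \<inter> Y \<in> W"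
  using ultrafilter unfolding ultrafilter_on_def by meson

lemma W_nonempty: "X \<in> W \<Longrightarrow> \<exists>x. x \<in> X"
  using ultrafilter unfolding ultrafilter_on_def by (metis ex_in_conv)

lemma W_not: "{x \<in> elts \<kappa>. P x} \<notin> W \<Longrightarrow> {x \<in> elts \<kappa>. \<not> P x} \<in> W"
proof -
  have "elts \<kappa> - {x \<in> elts \<kappa>. P x} = {x \<in> elts \<kappa>. \<not> P x}" by auto
  moreover have "{x \<in> elts \<kappa>. P x} \<in> W \<or> elts \<kappa> - {x \<in> elts \<kappa>. P x} \<in> W"
    using ultrafilter unfolding ultrafilter_on_def by (elim conjE allE[of _ "{x \<in> elts \<kappa>. P x}"]) blast
  ultimately show "{x \<in> elts \<kappa>. P x} \<notin> W \<Longrightarrow> {x \<in> elts \<kappa>. \<not> P x} \<in> W" by auto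
qed

lemma W_INT:
  assumes "I \<prec> elts \<kappa>" "\<And>i. i \<in> I \<Longrightarrow> {x \<in> elts \<kappa>. P i x} \<in> W"
  shows "{x \<in> elts \<kappa>. \<forall>i\<in>I. P i x} \<in> W"
proof (cases "I = {}")
  case True
  then show ?thesis using W_top by simp
next
  case False
  let ?F = "(\<lambda>i. {x \<in> elts \<kappa>. P i x}) ` I"
  have "\<Inter>?F \<in> W"
  proof (rule complete)
    show "?F \<prec> elts \<kappa>" using image_lepoll assms(1) lesspoll_trans1 by blast
  qed (use assms(2) False in auto)
  moreover have "\<Inter>?F = {x \<in> elts \<kappa>. \<forall>i\<in>I. P i x}" using False by auto
  ultimately show ?thesis by simp
qed

lemma countable_less_kappa: "countable I \<Longrightarrow> I \<prec> elts \<kappa>"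
  using countable_lesspoll_uncountable uncountable_kappa by blast

lemma less_kappa: "\<xi> \<in> elts \<kappa> \<Longrightarrow> elts \<xi> \<prec> elts \<kappa>"
  using Card_lesspoll Card_kappa by blast

lemma W_all_countable:
  assumes "\<And>i::'i::countable. {x \<in> elts \<kappa>. P i x} \<in> W"
  shows "{x \<in> elts \<kappa>. \<forall>i. P i x} \<in> W"
  using W_INT[OF countable_less_kappa[of UNIV], of P] assms by simp

lemma W_all_less:
  assumes "\<xi> \<in> elts \<kappa>" "\<And>\<eta>. \<eta> \<in> elts \<xi> \<Longrightarrow> {x \<in> elts \<kappa>. P \<eta> x} \<in> W"
  shows "{x \<in> elts \<kappa>. \<forall>\<eta>\<in>elts \<xi>. P \<eta> x} \<in> W"
  using W_INT[of "elts \<xi>" P] less_kappa assms by blast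

lemma W_conj:
  assumes "{x \<in> elts \<kappa>. P x} \<in> W" "{x \<in> elts \<kappa>. Q x} \<in> W"
  shows "{x \<in> elts \<kappa>. P x \<and> Q x} \<in> W"
proof -
  have "{x \<in> elts \<kappa>. P x} \<inter> {x \<in> elts \<kappa>. Q x} = {x \<in> elts \<kappa>. P x \<and> Q x}" by blast
  then show ?thesis using W_Int[OF assms] by simp
qed

lemma W_imp:
  assumes "{x \<in> elts \<kappa>. P x} \<in> W" "\<And>x. x \<in> elts \<kappa> \<Longrightarrow> P x \<Longrightarrow> Q x"
  shows "{x \<in> elts \<kappa>. Q x} \<in> W"
  using W_mono[OF assms(1), of "{x \<in> elts \<kappa>. Q x}"] assms(2) by blast

lemma W_ex: "{x \<in> elts \<kappa>. P x} \<in> W \<Longrightarrow> \<exists>x\<in>elts \<kappa>. P x"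
  using W_nonempty by blast

lemma W_neq: "\<eta> \<in> elts \<kappa> \<Longrightarrow> {x \<in> elts \<kappa>. x \<noteq> \<eta>} \<in> W"
  using W_not[of "\<lambda>x. x = \<eta>"] nonprincipal[of \<eta>] by (metis (mono_tags, lifting) Collect_cong singleton_conv)

text \<open>The point \<xi> and the fewer than \<kappa> points below it are each avoided almost
  everywhere.\<close>

lemma W_tail:
  assumes "\<xi> \<in> elts \<kappa>"
  shows "{x \<in> elts \<kappa>. \<xi> \<in> elts x} \<in> W"
proof -
  have "{x \<in> elts \<kappa>. \<forall>\<eta>\<in>elts \<xi>. x \<noteq> \<eta>} \<in> W"
    using W_all_less[OF assms, of "\<lambda>\<eta> x. x \<noteq> \<eta>"] W_neq below_kappa[OF assms] by blast
  from W_conj[OF W_neq[OF assms] this] show ?thesis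
    by (rule W_imp) (use Ord_linear Ord_in_kappa assms in blast)
qed

text \<open>Otherwise each of the fewer than \<kappa> values would be avoided almost everywhere, and
  by completeness all would be avoided at once.\<close>

lemma W_constant_below:
  assumes "\<xi> \<in> elts \<kappa>" "{x \<in> elts \<kappa>. g x \<in> elts \<xi>} \<in> W"
  shows "\<exists>\<eta>\<in>elts \<xi>. {x \<in> elts \<kappa>. g x = \<eta>} \<in> W"
proof (rule ccontr)
  assume "\<not> ?thesis"
  then have "{x \<in> elts \<kappa>. g x \<noteq> \<eta>} \<in> W" if "\<eta> \<in> elts \<xi>" for \<eta>
    using W_not[of "\<lambda>x. g x = \<eta>"] that by blast
  then have "{x \<in> elts \<kappa>. \<forall>\<eta>\<in>elts \<xi>. g x \<noteq> \<eta>} \<in> W"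
    using W_all_less[OF assms(1), of "\<lambda>\<eta> x. g x \<noteq> \<eta>"] by blast
  from W_ex[OF W_conj[OF this assms(2)]] show False by blast
qed

lemma no_last: "\<xi> \<in> elts \<kappa> \<Longrightarrow> \<exists>\<eta>\<in>elts \<kappa>. \<xi> \<in> elts \<eta>"
  using W_ex[OF W_tail] by blast

end

locale normal_ultrafilter = complete_ultrafilter \<kappa> W for \<kappa> :: "'v::set_universe" and W +
  assumes normal: "{x \<in> elts \<kappa>. g x \<in> elts x} \<in> W \<Longrightarrow> \<exists>\<eta>\<in>elts \<kappa>. {x \<in> elts \<kappa>. g x = \<eta>} \<in> W"
begin

text \<open>Otherwise picking a bad \<xi> below almost every x gives a regressive function. By
  normality it has a constant value on a set in \<open>W\<close>, contrary to the hypothesis for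
  that value.\<close>

lemma W_diagonal:
  assumes "\<And>\<xi>. \<xi> \<in> elts \<kappa> \<Longrightarrow> {x \<in> elts \<kappa>. P \<xi> x} \<in> W"
  shows "{x \<in> elts \<kappa>. \<forall>\<xi>\<in>elts x. P \<xi> x} \<in> W"
proof (rule ccontr)
  assume "{x \<in> elts \<kappa>. \<forall>\<xi>\<in>elts x. P \<xi> x} \<notin> W"
  then have *: "{x \<in> elts \<kappa>. \<not> (\<forall>\<xi>\<in>elts x. P \<xi> x)} \<in> W" by (rule W_not)
  define g where "g x = (SOME \<xi>. \<xi> \<in> elts x \<and> \<not> P \<xi> x)" for x
  have g: "g x \<in> elts x \<and> \<not> P (g x) x" if "\<not> (\<forall>\<xi>\<in>elts x. P \<xi> x)" for x
    using that someI_ex[of "\<lambda>\<xi>. \<xi> \<in> elts x \<and> \<not> P \<xi> x"] unfolding g_def by blast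
  have "{x \<in> elts \<kappa>. g x \<in> elts x} \<in> W" using * by (rule W_imp) (use g in blast)
  then obtain \<eta> where \<eta>: "\<eta> \<in> elts \<kappa>" "{x \<in> elts \<kappa>. g x = \<eta>} \<in> W" using normal by blast
  from W_ex[OF W_conj[OF * W_conj[OF \<eta>(2) assms[OF \<eta>(1)]]]] g show False by blast
qed

end

text \<open>Among the functions from \<open>\<kappa>\<close> to \<open>\<kappa>\<close> that are not bounded modulo the given ultrafilter,
  choose one that is minimal modulo the ultrafilter; the image of the ultrafilter under it is normal.\<close>

lemma (in complete_ultrafilter) normal_ultrafilter_ex:
  "\<exists>W'. normal_ultrafilter \<kappa> W'"
proof -
  define G where "G = {f :: 'v \<Rightarrow> 'v. (\<forall>x\<in>elts \<kappa>. f x \<in> elts \<kappa>) \<and> (\<forall>\<xi>\<in>elts \<kappa>. {x \<in> elts \<kappa>. \<xi> \<in> elts (f x)} \<in> W)}"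
  define R where "R = {(g :: 'v \<Rightarrow> 'v, f :: 'v \<Rightarrow> 'v). {x \<in> elts \<kappa>. g x \<in> elts (f x)} \<in> W}"
  \<comment> \<open>A descending sequence modulo \<open>W\<close> would, by countable completeness,
    be a descending membership sequence at a single point.\<close>
  have "wf R"
    unfolding wf_iff_no_infinite_down_chain
  proof
    assume "\<exists>f. \<forall>i. (f (Suc i), f i) \<in> R"
    then obtain f where "\<forall>i. (f (Suc i), f i) \<in> R" by blast
    then have "{x \<in> elts \<kappa>. \<forall>i. f (Suc i) x \<in> elts (f i x)} \<in> W"
      by (intro W_all_countable) (simp add: R_def)
    from W_ex[OF this] obtain x where "\<forall>i. f (Suc i) x \<in> elts (f i x)" by blast
    then have "\<exists>h::nat \<Rightarrow> 'v. \<forall>i. (h (Suc i), h i) \<in> {(x, y). x \<in> elts y}"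
      by (intro exI[of _ "\<lambda>i. f i x"]) simp
    then show False using foundation unfolding wf_iff_no_infinite_down_chain by blast
  qed
  moreover have "(\<lambda>x. x) \<in> G" using W_tail by (simp add: G_def)
  ultimately obtain f where f: "f \<in> G" and fmin: "\<And>g. (g, f) \<in> R \<Longrightarrow> g \<notin> G"
    unfolding wf_eq_minimal by blast
  have fK: "f x \<in> elts \<kappa>" if "x \<in> elts \<kappa>" for x using f that by (simp add: G_def)
  define W' where "W' = {X. X \<subseteq> elts \<kappa> \<and> {x \<in> elts \<kappa>. f x \<in> X} \<in> W}"
  have W': "{x \<in> elts \<kappa>. P x} \<in> W' \<longleftrightarrow> {x \<in> elts \<kappa>. P (f x)} \<in> W" for P
  proof -
    have "{x \<in> elts \<kappa>. f x \<in> {x \<in> elts \<kappa>. P x}} = {x \<in> elts \<kappa>. P (f x)}" using fK by blast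
    then show ?thesis unfolding W'_def by simp
  qed
  have "normal_ultrafilter \<kappa> W'"
  proof unfold_locales
    show "Card \<kappa>" "uncountable (elts \<kappa>)" by (fact Card_kappa uncountable_kappa)+
    show "ultrafilter_on (elts \<kappa>) W'"
      unfolding ultrafilter_on_def
    proof (intro conjI allI ballI impI)
      show "W' \<subseteq> Pow (elts \<kappa>)" by (auto simp: W'_def)
      show "elts \<kappa> \<in> W'" using W'[of "\<lambda>x. True"] W_top by simp
      show "{} \<notin> W'" using W'[of "\<lambda>x. False"] W_ex[of "\<lambda>x. False"] by auto
    next
      fix A B assume "A \<in> W'" "A \<subseteq> B \<and> B \<subseteq> elts \<kappa>"
      then show "B \<in> W'" unfolding W'_def using W_imp[of "\<lambda>x. f x \<in> A" "\<lambda>x. f x \<in> B"] by blast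
    next
      fix A B assume "A \<in> W'" "B \<in> W'"
      then show "A \<inter> B \<in> W'" unfolding W'_def using W_conj[of "\<lambda>x. f x \<in> A" "\<lambda>x. f x \<in> B"] by auto
    next
      fix A assume A: "A \<subseteq> elts \<kappa>"
      have "{x \<in> elts \<kappa>. f x \<in> elts \<kappa> - A} = {x \<in> elts \<kappa>. f x \<notin> A}" using fK by blast
      then show "A \<in> W' \<or> elts \<kappa> - A \<in> W'"
        unfolding W'_def using W_not[of "\<lambda>x. f x \<in> A"] A by auto
    qed
    show "{\<xi>} \<notin> W'" if \<xi>: "\<xi> \<in> elts \<kappa>" for \<xi>
    proof
      assume "{\<xi>} \<in> W'"
      then have "{x \<in> elts \<kappa>. f x = \<xi>} \<in> W" by (simp add: W'_def)
      moreover have "{x \<in> elts \<kappa>. \<xi> \<in> elts (f x)} \<in> W" using f \<xi> by (simp add: G_def)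
      ultimately have "\<exists>x\<in>elts \<kappa>. f x = \<xi> \<and> \<xi> \<in> elts (f x)" by (intro W_ex W_conj)
      then show False by auto
    qed
    show "\<Inter>F \<in> W'" if F: "F \<subseteq> W'" "F \<noteq> {}" "F \<prec> elts \<kappa>" for F
    proof -
      have "{x \<in> elts \<kappa>. \<forall>X\<in>F. f x \<in> X} \<in> W"
        using W_INT[OF F(3), of "\<lambda>X x. f x \<in> X"] F(1) unfolding W'_def by blast
      moreover have "\<Inter>F \<subseteq> elts \<kappa>" using F(1,2) unfolding W'_def by blast
      ultimately show ?thesis unfolding W'_def by auto
    qed
    fix g assume "{x \<in> elts \<kappa>. g x \<in> elts x} \<in> W'"
    then have g: "{x \<in> elts \<kappa>. g (f x) \<in> elts (f x)} \<in> W" using W' by simp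
    \<comment> \<open>\<open>h\<close> agrees with g \<circ> f almost everywhere and is corrected
      elsewhere, since members of \<open>G\<close> must map all of \<kappa> into \<kappa>. It is
      below f modulo \<open>W\<close>, so minimality of f makes it bounded.\<close>
    define h where "h x = (if g (f x) \<in> elts (f x) then g (f x) else x)" for x
    have "{x \<in> elts \<kappa>. h x \<in> elts (f x)} \<in> W" using g by (rule W_imp) (simp add: h_def)
    then have "h \<notin> G" using fmin by (simp add: R_def)
    moreover have hK: "h x \<in> elts \<kappa>" if "x \<in> elts \<kappa>" for x
      using that fK below_kappa by (auto simp: h_def)
    ultimately obtain \<xi> where \<xi>: "\<xi> \<in> elts \<kappa>" "{x \<in> elts \<kappa>. \<xi> \<in> elts (h x)} \<notin> W"
      unfolding G_def by blast
    \<comment> \<open>Almost everywhere \<open>h\<close> is at most \<xi>; a strict bound \<zeta> is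
      needed to find a constant value.\<close>
    obtain \<zeta> where \<zeta>: "\<zeta> \<in> elts \<kappa>" "\<xi> \<in> elts \<zeta>" using no_last \<xi>(1) by blast
    from W_not[OF \<xi>(2)] have "{x \<in> elts \<kappa>. h x \<in> elts \<zeta>} \<in> W"
    proof (rule W_imp)
      fix x assume x: "x \<in> elts \<kappa>" "\<xi> \<notin> elts (h x)"
      then have "h x = \<xi> \<or> h x \<in> elts \<xi>" using Ord_linear Ord_in_kappa \<xi>(1) hK by blast
      then show "h x \<in> elts \<zeta>" using \<zeta> Ord_trans Ord_in_kappa by blast
    qed
    then obtain \<eta> where \<eta>: "\<eta> \<in> elts \<zeta>" "{x \<in> elts \<kappa>. h x = \<eta>} \<in> W"
      using W_constant_below \<zeta>(1) by blast
    have "{x \<in> elts \<kappa>. g (f x) = \<eta>} \<in> W"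
      using W_conj[OF \<eta>(2) g] by (rule W_imp) (auto simp: h_def)
    then show "\<exists>\<eta>\<in>elts \<kappa>. {x \<in> elts \<kappa>. g x = \<eta>} \<in> W'"
      using W' \<eta>(1) \<zeta>(1) below_kappa by auto
  qed
  then show ?thesis by blast
qed

lemma measurable_cardinal_normal:
  "measurable_cardinal \<kappa> \<Longrightarrow> \<exists>W. normal_ultrafilter \<kappa> W"
  unfolding measurable_cardinal_def
  by (metis complete_ultrafilter.intro complete_ultrafilter.normal_ultrafilter_ex)

section \<open>Homogeneous sets and enumerations\<close>

context complete_ultrafilter
begin

text \<open>The iterated quantifier "for almost every x_1, for almost every x_2, and so on up to
  x_n": membership in the n-fold product of \<open>W\<close>, with s as a fixed beginning.\<close>

primrec almost_all :: "nat \<Rightarrow> ('v list \<Rightarrow> bool) \<Rightarrow> 'v list \<Rightarrow> bool" where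
  "almost_all 0 P s \<longleftrightarrow> P s"
| "almost_all (Suc n) P s \<longleftrightarrow> {x \<in> elts \<kappa>. almost_all n P (s @ [x])} \<in> W"

text \<open>An ultrafilter decides every predicate, so almost every next point agrees with the
  majority verdict, whichever it is.\<close>

lemma almost_all_stable: "{x \<in> elts \<kappa>. almost_all n P (s @ [x]) \<longleftrightarrow> almost_all (Suc n) P s} \<in> W"
  using W_not[of "\<lambda>x. almost_all n P (s @ [x])"]
  by (cases "{x \<in> elts \<kappa>. almost_all n P (s @ [x])} \<in> W") simp_all

text \<open>Induction on the length uses completeness once per entry, each time for the fewer than
  \<kappa> possible values of that entry.\<close>

lemma W_all_lists_length:
  assumes "\<xi> \<in> elts \<kappa>" "\<And>s. set s \<subseteq> elts \<xi> \<Longrightarrow> {x \<in> elts \<kappa>. P s x} \<in> W"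
  shows "{x \<in> elts \<kappa>. \<forall>s. length s = n \<and> set s \<subseteq> elts \<xi> \<longrightarrow> P s x} \<in> W"
  using assms(2)
proof (induction n arbitrary: P)
  case 0
  from 0[of "[]"] show ?case by (auto elim: W_imp)
next
  case (Suc n)
  have "{x \<in> elts \<kappa>. \<forall>s. length s = n \<and> set s \<subseteq> elts \<xi> \<longrightarrow> P (\<eta> # s) x} \<in> W" if "\<eta> \<in> elts \<xi>" for \<eta>
    by (rule Suc.IH) (use Suc.prems that in auto)
  then have "{x \<in> elts \<kappa>. \<forall>\<eta>\<in>elts \<xi>. \<forall>s. length s = n \<and> set s \<subseteq> elts \<xi> \<longrightarrow> P (\<eta> # s) x} \<in> W"
    using W_all_less[OF assms(1), of "\<lambda>\<eta> x. \<forall>s. length s = n \<and> set s \<subseteq> elts \<xi> \<longrightarrow> P (\<eta> # s) x"] by blast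
  then show ?case by (rule W_imp) (auto simp: length_Suc_conv)
qed

lemma W_all_lists:
  assumes "\<xi> \<in> elts \<kappa>" "\<And>s. set s \<subseteq> elts \<xi> \<Longrightarrow> {x \<in> elts \<kappa>. P s x} \<in> W"
  shows "{x \<in> elts \<kappa>. \<forall>s. set s \<subseteq> elts \<xi> \<longrightarrow> P s x} \<in> W"
proof -
  have "{x \<in> elts \<kappa>. \<forall>n s. length s = n \<and> set s \<subseteq> elts \<xi> \<longrightarrow> P s x} \<in> W"
    by (intro W_all_countable W_all_lists_length assms)
  then show ?thesis by simp
qed

text \<open>The increasing enumeration of \<open>B\<close>. The choice is meaningful only where a
  least suitable element exists, which lemma \<open>enum\<close> shows for B in
  \<open>W\<close>.\<close>

function enum :: "'v set \<Rightarrow> 'v \<Rightarrow> 'v" where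
  "enum B \<alpha> = (SOME x. x \<in> B \<and> (\<forall>\<beta>\<in>elts \<alpha>. enum B \<beta> \<in> elts x) \<and>
     (\<forall>y\<in>B. (\<forall>\<beta>\<in>elts \<alpha>. enum B \<beta> \<in> elts y) \<longrightarrow> y = x \<or> x \<in> elts y))"
  by pat_completeness auto
termination
  by (relation "inv_image {(x, y). x \<in> elts y} snd") (auto simp: foundation)

declare enum.simps [simp del]

text \<open>There are fewer than \<kappa> earlier values, so almost every x lies above all of them,
  and some such x is in \<open>B\<close>.\<close>

lemma enum:
  assumes "B \<in> W" "\<alpha> \<in> elts \<kappa>"
  shows "enum B \<alpha> \<in> B \<and> (\<forall>\<beta>\<in>elts \<alpha>. enum B \<beta> \<in> elts (enum B \<alpha>)) \<and>
     (\<forall>y\<in>B. (\<forall>\<beta>\<in>elts \<alpha>. enum B \<beta> \<in> elts y) \<longrightarrow> y = enum B \<alpha> \<or> enum B \<alpha> \<in> elts y)"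
  using assms(2)
proof (induction \<alpha> rule: elts_induct)
  case (step \<alpha>)
  have BK: "B \<subseteq> elts \<kappa>" using assms(1) W_subset by blast
  have "{x \<in> elts \<kappa>. \<forall>\<beta>\<in>elts \<alpha>. enum B \<beta> \<in> elts x} \<in> W"
  proof (rule W_all_less[OF step(2)])
    fix \<beta> assume "\<beta> \<in> elts \<alpha>"
    then show "{x \<in> elts \<kappa>. enum B \<beta> \<in> elts x} \<in> W"
      using W_tail step below_kappa BK by blast
  qed
  from W_nonempty[OF W_Int[OF assms(1) this]]
  obtain x where "x \<in> elts \<kappa>" "x \<in> B \<and> (\<forall>\<beta>\<in>elts \<alpha>. enum B \<beta> \<in> elts x)" by blast
  then obtain y where "y \<in> B \<and> (\<forall>\<beta>\<in>elts \<alpha>. enum B \<beta> \<in> elts y)"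
    "\<And>z. z \<in> elts \<kappa> \<Longrightarrow> z \<in> B \<and> (\<forall>\<beta>\<in>elts \<alpha>. enum B \<beta> \<in> elts z) \<Longrightarrow> z = y \<or> y \<in> elts z"
    using Ord_least[OF Ord_kappa, of x "\<lambda>x. x \<in> B \<and> (\<forall>\<beta>\<in>elts \<alpha>. enum B \<beta> \<in> elts x)"] by metis
  then have "y \<in> B \<and> (\<forall>\<beta>\<in>elts \<alpha>. enum B \<beta> \<in> elts y) \<and>
    (\<forall>z\<in>B. (\<forall>\<beta>\<in>elts \<alpha>. enum B \<beta> \<in> elts z) \<longrightarrow> z = y \<or> y \<in> elts z)"
    using BK by blast
  from someI[of "\<lambda>y. y \<in> B \<and> (\<forall>\<beta>\<in>elts \<alpha>. enum B \<beta> \<in> elts y) \<and>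
    (\<forall>z\<in>B. (\<forall>\<beta>\<in>elts \<alpha>. enum B \<beta> \<in> elts z) \<longrightarrow> z = y \<or> y \<in> elts z)", OF this]
  show ?case unfolding enum.simps[of B \<alpha>, symmetric] .
qed

lemma enum_in: "B \<in> W \<Longrightarrow> \<alpha> \<in> elts \<kappa> \<Longrightarrow> enum B \<alpha> \<in> B"
  using enum by blast

lemma enum_in_kappa: "B \<in> W \<Longrightarrow> \<alpha> \<in> elts \<kappa> \<Longrightarrow> enum B \<alpha> \<in> elts \<kappa>"
  using enum_in W_subset by blast

lemma enum_less: "B \<in> W \<Longrightarrow> \<alpha> \<in> elts \<kappa> \<Longrightarrow> \<beta> \<in> elts \<alpha> \<Longrightarrow> enum B \<beta> \<in> elts (enum B \<alpha>)"
  using enum by blast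

lemma enum_increasing: "B \<in> W \<Longrightarrow> increasing_on (elts \<kappa>) (enum B)"
  unfolding increasing_on_def using enum_less by blast

lemma enum_ge: "B \<in> W \<Longrightarrow> \<alpha> \<in> elts \<kappa> \<Longrightarrow> enum B \<alpha> = \<alpha> \<or> \<alpha> \<in> elts (enum B \<alpha>)"
  by (rule increasing_on_ge[OF Ord_kappa enum_increasing]) (auto intro: Ord_in_kappa enum_in_kappa)

text \<open>Take the least \<alpha> whose value is not below x. All earlier values are below x, so
  the value at \<alpha> is at most x, hence equal to it.\<close>

lemma enum_onto:
  assumes "B \<in> W" "x \<in> B" obtains \<alpha> where "\<alpha> \<in> elts \<kappa>" "enum B \<alpha> = x"
proof -
  have xK: "x \<in> elts \<kappa>" using assms W_subset by blast
  then have "enum B x \<notin> elts x" using enum_ge[OF assms(1) xK] mem_asym by (metis mem_not_refl)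
  with xK obtain \<alpha> where \<alpha>: "\<alpha> \<in> elts \<kappa>" "enum B \<alpha> \<notin> elts x"
    and min: "\<And>\<beta>. \<beta> \<in> elts \<kappa> \<Longrightarrow> enum B \<beta> \<notin> elts x \<Longrightarrow> \<beta> = \<alpha> \<or> \<alpha> \<in> elts \<beta>"
    using Ord_least[OF Ord_kappa, of x "\<lambda>\<alpha>. enum B \<alpha> \<notin> elts x"] by metis
  have "\<forall>\<beta>\<in>elts \<alpha>. enum B \<beta> \<in> elts x"
    using min below_kappa[OF \<alpha>(1)] mem_asym mem_not_refl by metis
  then have "x = enum B \<alpha>" using enum[OF assms(1) \<alpha>(1)] assms(2) \<alpha>(2) by blast
  then show thesis using that \<alpha>(1) by blast
qed

end

abbreviation (input) increasing :: "'v::set_universe list \<Rightarrow> bool" where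
  "increasing \<equiv> sorted_wrt (\<lambda>x y. x \<in> elts y)"

text \<open>This is Rowbottom's theorem. Appended to any increasing list below it, a point of
  \<open>D\<close> gives the same verdict as almost every point does. Removing last entries one at a
  time therefore turns the truth of \<open>P i s\<close> into an iterated quantifier that sees only
  the length of s.\<close>

theorem (in normal_ultrafilter) homogeneous_set_ex:
  fixes P :: "'i::countable \<Rightarrow> 'v list \<Rightarrow> bool"
  obtains D where "D \<in> W"
    "\<And>i s t. \<lbrakk>increasing s; increasing t; set s \<subseteq> D; set t \<subseteq> D; length s = length t\<rbrakk> \<Longrightarrow> P i s \<longleftrightarrow> P i t"
proof -
  define good where "good s x \<longleftrightarrow> (\<forall>i n. almost_all n (P i) (s @ [x]) \<longleftrightarrow> almost_all (Suc n) (P i) s)" for s x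
  have good: "{x \<in> elts \<kappa>. good s x} \<in> W" for s
    unfolding good_def by (intro W_all_countable almost_all_stable)
  have tail: "{x \<in> elts \<kappa>. \<forall>\<xi>\<in>elts x. \<forall>s. set s \<subseteq> elts \<xi> \<longrightarrow> good (s @ [\<xi>]) x} \<in> W"
    by (intro W_diagonal W_all_lists good)
  \<comment> \<open>A nonempty increasing list below x is split as s @ [\<xi>], so that s ranges
    over lists below \<xi> and completeness handles them all; the empty list is treated
    separately.\<close>
  define D where "D = {x \<in> elts \<kappa>. good [] x \<and> (\<forall>\<xi>\<in>elts x. \<forall>s. set s \<subseteq> elts \<xi> \<longrightarrow> good (s @ [\<xi>]) x)}"
  have "D \<in> W" unfolding D_def by (rule W_conj[OF good tail])
  have *: "almost_all m (P i) s \<longleftrightarrow> almost_all (m + length s) (P i) []"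
    if "increasing s" "set s \<subseteq> D" for i m s
    using that
  proof (induction s arbitrary: m rule: rev_induct)
    case (snoc x s)
    have "good s x"
    proof (cases s rule: rev_cases)
      case (snoc l \<xi>)
      then have "set l \<subseteq> elts \<xi>" "\<xi> \<in> elts x" "x \<in> D" using snoc.prems by (auto simp: sorted_wrt_append)
      then show ?thesis using snoc unfolding D_def by blast
    qed (use snoc.prems in \<open>simp add: D_def\<close>)
    then have "almost_all m (P i) (s @ [x]) \<longleftrightarrow> almost_all (Suc m) (P i) s" by (simp only: good_def)
    also have "\<dots> \<longleftrightarrow> almost_all (Suc m + length s) (P i) []"
      by (rule snoc.IH) (use snoc.prems in \<open>auto simp: sorted_wrt_append\<close>)
    finally show ?case by (simp only: length_append list.size add_Suc add_Suc_right add_0_right)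
  qed simp
  have "P i s \<longleftrightarrow> P i t"
    if "increasing s" "increasing t" "set s \<subseteq> D" "set t \<subseteq> D" "length s = length t" for i s t
    using *[of s 0 i] *[of t 0 i] that by simp
  with \<open>D \<in> W\<close> show thesis by (rule that)
qed

section \<open>Skolem terms\<close>

text \<open>The type of variables is left open: ordinals name indiscernibles, a sum type holds two
  blocks of them, and natural numbers give only countably many terms.\<close>

datatype 'a tm = Var 'a | Sk fm nat "'a tm list"

instance fm :: countable by countable_datatype
instance tm :: (countable) countable by countable_datatype

text \<open>\<open>sat\<close> needs total assignments, so a list is padded with a default member of
  \<open>A\<close>; \<open>skolem\<close> falls back on the same default where there is no
  witness.\<close>

definition env :: "'v set \<Rightarrow> 'v list \<Rightarrow> nat \<Rightarrow> 'v" where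
  "env A xs k = (if k < length xs then xs ! k else (SOME z. z \<in> A))"

definition skolem :: "'v::set_universe set \<Rightarrow> fm \<Rightarrow> nat \<Rightarrow> 'v list \<Rightarrow> 'v" where
  "skolem A \<phi> i xs =
     (if \<exists>a\<in>A. sat A ((env A xs)(i := a)) \<phi> then (SOME a. a \<in> A \<and> sat A ((env A xs)(i := a)) \<phi>)
      else (SOME z. z \<in> A))"

primrec ev :: "'v::set_universe set \<Rightarrow> ('x \<Rightarrow> 'v) \<Rightarrow> 'x tm \<Rightarrow> 'v" where
  "ev A \<sigma> (Var x) = \<sigma> x"
| "ev A \<sigma> (Sk \<phi> i ts) = skolem A \<phi> i (map (ev A \<sigma>) ts)"

lemma skolem_in: "A \<noteq> {} \<Longrightarrow> skolem A \<phi> i xs \<in> A"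
  unfolding skolem_def
  using someI_ex[of "\<lambda>a. a \<in> A \<and> sat A ((env A xs)(i := a)) \<phi>"] some_in_eq[of A] by auto

lemma skolem_sat:
  "a \<in> A \<Longrightarrow> sat A ((env A xs)(i := a)) \<phi> \<Longrightarrow> sat A ((env A xs)(i := skolem A \<phi> i xs)) \<phi>"
  unfolding skolem_def
  using someI_ex[of "\<lambda>a. a \<in> A \<and> sat A ((env A xs)(i := a)) \<phi>"] by auto

lemma ev_map_tm: "ev A \<sigma> (map_tm f t) = ev A (\<sigma> \<circ> f) t"
proof (induction t)
  case (Sk \<phi> i ts)
  then have "map (ev A \<sigma>) (map (map_tm f) ts) = map (ev A (\<sigma> \<circ> f)) ts" by (simp add: comp_def)
  then show ?case by (simp only: tm.map ev.simps)
qed simp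

lemma ev_cong: "(\<And>x. x \<in> set_tm t \<Longrightarrow> \<sigma> x = \<tau> x) \<Longrightarrow> ev A \<sigma> t = ev A \<tau> t"
proof (induction t)
  case (Sk \<phi> i ts)
  then have "map (ev A \<sigma>) ts = map (ev A \<tau>) ts" by auto
  then show ?case by (simp only: ev.simps)
qed simp

lemma ev_in: "A \<noteq> {} \<Longrightarrow> (\<And>x. x \<in> set_tm t \<Longrightarrow> \<sigma> x \<in> A) \<Longrightarrow> ev A \<sigma> t \<in> A"
  by (cases t) (simp_all add: skolem_in)

lemma finite_set_tm: "finite (set_tm t)"
  by (induction t) auto

text \<open>Only finitely many entries of an assignment matter to a formula. This bound, which may
  count bound variables as well, lets a list of parameters replace the assignment.\<close>

primrec var_bound :: "fm \<Rightarrow> nat" where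
  "var_bound (Mem i k) = Suc (max i k)"
| "var_bound (Equal i k) = Suc (max i k)"
| "var_bound (Neg \<phi>) = var_bound \<phi>"
| "var_bound (Conj \<phi> \<psi>) = max (var_bound \<phi>) (var_bound \<psi>)"
| "var_bound (Exists i \<phi>) = var_bound \<phi>"

lemma sat_cong: "(\<And>k. k < var_bound \<phi> \<Longrightarrow> s k = s' k) \<Longrightarrow> sat A s \<phi> \<longleftrightarrow> sat A s' \<phi>"
proof (induction \<phi> arbitrary: s s')
  case (Exists i \<phi>)
  have "sat A (s(i := a)) \<phi> \<longleftrightarrow> sat A (s'(i := a)) \<phi>" for a
    by (rule Exists.IH) (use Exists.prems in auto)
  then show ?case by simp
next
  case (Conj \<phi> \<psi>)
  have "sat A s \<phi> \<longleftrightarrow> sat A s' \<phi>" "sat A s \<psi> \<longleftrightarrow> sat A s' \<psi>"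
    by (rule Conj.IH, use Conj.prems in simp)+
  then show ?case by simp
next
  case (Neg \<phi>)
  have "sat A s \<phi> \<longleftrightarrow> sat A s' \<phi>" by (rule Neg.IH) (use Neg.prems in simp)
  then show ?case by simp
qed simp_all

lemma sat_iso:
  assumes "inj_on f H" "\<And>x y. x \<in> H \<Longrightarrow> y \<in> H \<Longrightarrow> x \<in> elts y \<longleftrightarrow> f x \<in> elts (f y)" "range s \<subseteq> H"
  shows "sat (f ` H) (f \<circ> s) \<phi> \<longleftrightarrow> sat H s \<phi>"
  using assms(3)
proof (induction \<phi> arbitrary: s)
  case (Mem i k)
  then show ?case using assms(2)[of "s i" "s k"] by auto
next
  case (Equal i k)
  then show ?case using inj_on_eq_iff[OF assms(1), of "s i" "s k"] by auto
next
  case (Exists i \<phi>)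
  have "sat (f ` H) ((f \<circ> s)(i := f a)) \<phi> \<longleftrightarrow> sat H (s(i := a)) \<phi>" if "a \<in> H" for a
  proof -
    have "(f \<circ> s)(i := f a) = f \<circ> s(i := a)" by auto
    moreover have "range (s(i := a)) \<subseteq> H" using Exists.prems that by auto
    ultimately show ?thesis using Exists.IH by metis
  qed
  then show ?case unfolding sat.simps by blast
qed simp_all

text \<open>The Tarski-Vaught criterion: a witness in \<open>A\<close> can be replaced by the value
  of a Skolem term applied to terms that name the parameters.\<close>

lemma sat_skolem_hull:
  fixes \<sigma> :: "'x \<Rightarrow> 'v::set_universe"
  assumes "\<And>x. x \<in> X \<Longrightarrow> \<sigma> x \<in> A" "A \<noteq> {}"
  assumes "range s \<subseteq> ev A \<sigma> ` {t. set_tm t \<subseteq> X}"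
  shows "sat (ev A \<sigma> ` {t. set_tm t \<subseteq> X}) s \<phi> \<longleftrightarrow> sat A s \<phi>"
  using assms(3)
proof (induction \<phi> arbitrary: s)
  case (Exists i \<phi>)
  let ?H = "ev A \<sigma> ` {t. set_tm t \<subseteq> X}"
  have HA: "?H \<subseteq> A"
    using ev_in[OF assms(2), of _ \<sigma>] assms(1) by blast
  have IH: "sat ?H (s(i := a)) \<phi> \<longleftrightarrow> sat A (s(i := a)) \<phi>" if "a \<in> ?H" for a
    by (rule Exists.IH) (use Exists.prems that in auto)
  have "\<exists>b\<in>?H. sat A (s(i := b)) \<phi>" if a: "a \<in> A" "sat A (s(i := a)) \<phi>" for a
  proof -
    have "\<forall>k. \<exists>t. s k = ev A \<sigma> t \<and> set_tm t \<subseteq> X" using Exists.prems by auto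
    then obtain ts where ts: "\<And>k. s k = ev A \<sigma> (ts k)" "\<And>k. set_tm (ts k) \<subseteq> X" by metis
    \<comment> \<open>A Skolem function takes a list, so only the entries of s that \<phi> can see
      are named.\<close>
    define us where "us = map ts [0..<var_bound \<phi>]"
    have env: "env A (map (ev A \<sigma>) us) k = s k" if "k < var_bound \<phi>" for k
      using that by (simp add: env_def us_def ts)
    define b where "b = ev A \<sigma> (Sk \<phi> i us)"
    have "sat A ((env A (map (ev A \<sigma>) us))(i := a)) \<phi>"
      using a(2) sat_cong[of \<phi> "(env A (map (ev A \<sigma>) us))(i := a)" "s(i := a)"] env by auto
    then have "sat A ((env A (map (ev A \<sigma>) us))(i := b)) \<phi>"
      unfolding b_def using skolem_sat[OF a(1)] by simp
    then have "sat A (s(i := b)) \<phi>"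
      using sat_cong[of \<phi> "(env A (map (ev A \<sigma>) us))(i := b)" "s(i := b)"] env by auto
    moreover have "b \<in> ?H" unfolding b_def using ts(2) by (intro imageI) (auto simp: us_def)
    ultimately show ?thesis by blast
  qed
  then have "(\<exists>a\<in>A. sat A (s(i := a)) \<phi>) \<longleftrightarrow> (\<exists>b\<in>?H. sat A (s(i := b)) \<phi>)"
    using HA by (meson subsetD)
  also have "\<dots> \<longleftrightarrow> (\<exists>b\<in>?H. sat ?H (s(i := b)) \<phi>)" by (simp only: IH cong: bex_cong)
  finally show ?case by (simp only: sat.simps)
qed auto

text \<open>A term is recovered from its shape, with numbered variables, and a list of its
  variables. Shapes are countable, and lists over \<open>B\<close> are no more numerous than
  \<open>B\<close>.\<close>

lemma terms_lepoll:
  assumes "infinite B" shows "{t. set_tm t \<subseteq> B} \<lesssim> B"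
proof -
  let ?h = "\<lambda>(t, xs). map_tm (\<lambda>n. xs ! n) (t :: nat tm)"
  have "{t. set_tm t \<subseteq> B} \<subseteq> ?h ` (UNIV \<times> lists B)"
  proof
    fix t assume "t \<in> {t. set_tm t \<subseteq> B}"
    obtain xs where xs: "set xs = set_tm t" using finite_list[OF finite_set_tm[of t]] by auto
    then have "\<forall>y. \<exists>n. y \<in> set_tm t \<longrightarrow> xs ! n = y" using in_set_conv_nth by metis
    then obtain p where p: "\<And>y. y \<in> set_tm t \<Longrightarrow> xs ! p y = y" by metis
    have "map_tm (\<lambda>n. xs ! n) (map_tm p t) = map_tm id t"
      unfolding tm.map_comp by (rule tm.map_cong) (use p in auto)
    then have "t = ?h (map_tm p t, xs)" by (simp add: tm.map_id)
    moreover have "xs \<in> lists B" using xs \<open>t \<in> {t. set_tm t \<subseteq> B}\<close> by auto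
    ultimately show "t \<in> ?h ` (UNIV \<times> lists B)"
      by (intro image_eqI[of _ _ "(map_tm p t, xs)"]) auto
  qed
  then have "{t. set_tm t \<subseteq> B} \<lesssim> (UNIV :: nat tm set) \<times> lists B" by (rule subset_image_lepoll)
  also have "\<dots> \<lesssim> (UNIV :: nat tm set) \<times> B"
    using lists_lepoll[OF assms] by (intro times_lepoll_mono) auto
  also have "\<dots> \<lesssim> B" using times_countable_lepoll[OF assms countableI_type] .
  finally show ?thesis .
qed

lemma increasing_list_ex:
  assumes "finite X" "\<And>x. x \<in> X \<Longrightarrow> Ord (x::'v::set_universe)"
  shows "\<exists>xs. increasing xs \<and> set xs = X"
  using assms
proof (induction X rule: finite_induct)
  case (insert a X)
  then obtain xs where xs: "increasing xs" "set xs = X" by auto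
  let ?ys = "filter (\<lambda>x. x \<in> elts a) xs @ [a] @ filter (\<lambda>x. a \<in> elts x) xs"
  have "increasing ?ys"
    using xs(1) Ord_trans[of _ _ a] Ord_trans[of _ a] insert.prems xs(2)
    by (auto simp: sorted_wrt_append sorted_wrt_filter)
  moreover have "x \<in> elts a \<or> a \<in> elts x" if "x \<in> X" for x
    using Ord_linear[of x a] that insert.prems insert.hyps(2) by blast
  then have "set ?ys = insert a X" using xs(2) by auto
  ultimately show ?case by blast
qed auto

text \<open>The variables carry no order; assignments are compared through the order of their
  values. For ordinal values this settles equalities too, by \<open>similar_on_eq\<close>.\<close>

definition similar_on :: "'x set \<Rightarrow> ('x \<Rightarrow> 'v::set_universe) \<Rightarrow> ('x \<Rightarrow> 'v) \<Rightarrow> bool" where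
  "similar_on X \<sigma> \<tau> \<longleftrightarrow> (\<forall>x\<in>X. \<forall>y\<in>X. \<sigma> x \<in> elts (\<sigma> y) \<longleftrightarrow> \<tau> x \<in> elts (\<tau> y))"

lemma increasing_on_similar:
  assumes "increasing_on X \<sigma>" "increasing_on X \<tau>" "\<And>x. x \<in> X \<Longrightarrow> Ord x"
  shows "similar_on X \<sigma> \<tau>"
  unfolding similar_on_def using increasing_on_iff[OF assms(1,3)] increasing_on_iff[OF assms(2,3)] by blast

lemma similar_on_eq:
  assumes "similar_on X \<sigma> \<tau>" "\<And>x. x \<in> X \<Longrightarrow> Ord (\<tau> x)" "x \<in> X" "y \<in> X" "\<sigma> x = \<sigma> y"
  shows "\<tau> x = \<tau> y"
  using assms Ord_linear[of "\<tau> x" "\<tau> y"] mem_not_refl unfolding similar_on_def by metis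

text \<open>A set is indiscernible for the Skolem expansion of \<open>A\<close> as soon as it is homogeneous for the
  countably many predicates indexed by a formula and a list of Skolem terms in numbered variables.\<close>

definition holds :: "'v::set_universe set \<Rightarrow> fm \<times> nat tm list \<Rightarrow> 'v list \<Rightarrow> bool" where
  "holds A = (\<lambda>(\<phi>, ts) xs. sat A (env A (map (ev A (\<lambda>n. xs ! n)) ts)) \<phi>)"

lemma homogeneous_imp_indiscernible:
  fixes \<sigma> \<tau> :: "'x \<Rightarrow> 'v::set_universe"
  assumes hom: "\<And>i s t. \<lbrakk>increasing s; increasing t; set s \<subseteq> D; set t \<subseteq> D; length s = length t\<rbrakk>
      \<Longrightarrow> holds A i s \<longleftrightarrow> holds A i t"
    and D: "\<And>x. x \<in> D \<Longrightarrow> Ord x"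
    and X: "finite X" "\<sigma> ` X \<subseteq> D" "\<tau> ` X \<subseteq> D" "similar_on X \<sigma> \<tau>" "\<And>k. set_tm (ts k) \<subseteq> X"
  shows "sat A (\<lambda>k. ev A \<sigma> (ts k)) \<phi> \<longleftrightarrow> sat A (\<lambda>k. ev A \<tau> (ts k)) \<phi>"
proof -
  obtain xs where xs: "increasing xs" "set xs = \<sigma> ` X"
    using increasing_list_ex[of "\<sigma> ` X"] X(1,2) D by blast
  have "\<forall>x. \<exists>n. x \<in> X \<longrightarrow> n < length xs \<and> xs ! n = \<sigma> x"
    using xs(2) by (metis image_eqI in_set_conv_nth)
  then obtain p where p: "\<And>x. x \<in> X \<Longrightarrow> p x < length xs \<and> xs ! p x = \<sigma> x" by metis
  \<comment> \<open>\<open>f\<close> carries each value under \<sigma> to the value of the same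
    variable under \<tau>; similarity makes the choice of the variable harmless.\<close>
  define f where "f u = \<tau> (SOME x. x \<in> X \<and> \<sigma> x = u)" for u
  have f: "f (\<sigma> x) = \<tau> x" if "x \<in> X" for x
  proof -
    have "(SOME y. y \<in> X \<and> \<sigma> y = \<sigma> x) \<in> X \<and> \<sigma> (SOME y. y \<in> X \<and> \<sigma> y = \<sigma> x) = \<sigma> x"
      by (rule someI[of "\<lambda>y. y \<in> X \<and> \<sigma> y = \<sigma> x" x]) (use that in simp)
    then show ?thesis unfolding f_def
      using similar_on_eq[OF X(4), of "SOME y. y \<in> X \<and> \<sigma> y = \<sigma> x" x] X(3) D that by blast
  qed
  \<comment> \<open>Renaming each variable to the position of its value in xs yields terms in
    numbered variables, so a single one of the countably many predicates decides both sides.\<close>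
  let ?us = "map (\<lambda>k. map_tm p (ts k)) [0..<var_bound \<phi>]"
  have eq: "holds A (\<phi>, ?us) ys \<longleftrightarrow> sat A (\<lambda>k. ev A \<rho> (ts k)) \<phi>"
    if "\<And>x. x \<in> X \<Longrightarrow> ys ! p x = \<rho> x" for ys \<rho>
  proof -
    have "ev A (\<lambda>n. ys ! n) (map_tm p (ts k)) = ev A \<rho> (ts k)" for k
      unfolding ev_map_tm by (rule ev_cong) (use X(5)[of k] that in auto)
    then show ?thesis unfolding holds_def by (auto intro!: sat_cong simp: env_def)
  qed
  have "increasing (map f xs)"
    unfolding sorted_wrt_map
  proof (rule sorted_wrt_mono_rel[OF _ xs(1)])
    fix u v assume "u \<in> set xs" "v \<in> set xs" "u \<in> elts v"
    then show "f u \<in> elts (f v)" using xs(2) f X(4) by (auto simp: similar_on_def)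
  qed
  moreover have "set (map f xs) \<subseteq> D" using xs(2) f X(3) by auto
  ultimately have "holds A (\<phi>, ?us) xs \<longleftrightarrow> holds A (\<phi>, ?us) (map f xs)"
    using hom[OF xs(1), of "map f xs"] xs(2) X(2) by auto
  then show ?thesis using eq[of xs \<sigma>] eq[of "map f xs" \<tau>] p f by simp
qed

section \<open>Collapsing hulls\<close>

text \<open>The Mostowski collapse of \<open>H\<close>, made total by \<open>SOME\<close>;
  \<open>elts_coll_aux\<close> gives the cases where the required set exists.\<close>

function coll :: "'v::set_universe set \<Rightarrow> 'v \<Rightarrow> 'v" where
  "coll H x = (SOME z. elts z = (\<Union>y\<in>elts x \<inter> H. {coll H y}))"
  by pat_completeness auto
termination
  by (relation "inv_image {(x, y). x \<in> elts y} snd") (auto simp: foundation)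

declare coll.simps [simp del]

text \<open>Without Replacement in the ambient universe, the image in question is a set because the
  collapse does not increase rank.\<close>

lemma elts_coll_aux:
  "Ord \<alpha> \<Longrightarrow> elts x \<subseteq> Vlevel \<alpha> \<Longrightarrow>
    elts (coll H x) = coll H ` (elts x \<inter> H) \<and> elts (coll H x) \<subseteq> Vlevel (\<alpha>::'v::set_universe)"
proof (induction x arbitrary: \<alpha> rule: elts_induct)
  case (step x)
  have "coll H y \<in> Vlevel \<alpha>" if y: "y \<in> elts x" for y
  proof -
    obtain \<beta> where "\<beta> \<in> elts \<alpha>" "elts y \<subseteq> Vlevel \<beta>" using y step(3) Vlevel_iff[of y \<alpha>] by blast
    then show ?thesis using step(1)[OF y, of \<beta>] Ord_in_Ord[OF step(2)] Vlevel_iff[of "coll H y" \<alpha>] by blast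
  qed
  then have sub: "coll H ` (elts x \<inter> H) \<subseteq> Vlevel \<alpha>" by blast
  obtain v where "elts v = Vlevel \<alpha>" using levels[OF step(2)] by blast
  then obtain z where "elts z = (\<Union>y\<in>elts x \<inter> H. {coll H y})"
    using separation[of "coll H ` (elts x \<inter> H)" v] sub unfolding UNION_singleton_eq_range by auto
  then have "elts (coll H x) = (\<Union>y\<in>elts x \<inter> H. {coll H y})"
    unfolding coll.simps[of H x] by (rule someI)
  then show ?case using sub by auto
qed

locale collapse =
  fixes \<kappa> :: "'v::set_universe" and H :: "'v set"
  assumes Ord_top: "Ord \<kappa>"
    and H_sub: "H \<subseteq> Vlevel \<kappa>"
    and H_ext: "\<And>x y. x \<in> H \<Longrightarrow> y \<in> H \<Longrightarrow> elts x \<inter> H = elts y \<inter> H \<Longrightarrow> x = y"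
begin

abbreviation \<pi> where "\<pi> \<equiv> coll H"

lemma elts_coll: "x \<in> H \<Longrightarrow> elts (\<pi> x) = \<pi> ` (elts x \<inter> H)"
  using elts_coll_aux[OF Ord_top, of x H] H_sub Vlevel_subset[OF Ord_top] by blast

lemma coll_in: assumes "x \<in> H" shows "\<pi> x \<in> Vlevel \<kappa>"
proof -
  obtain \<beta> where "\<beta> \<in> elts \<kappa>" "elts x \<subseteq> Vlevel \<beta>" using assms H_sub Vlevel_iff[of x \<kappa>] by blast
  then show ?thesis using elts_coll_aux[of \<beta> x H] Ord_in_Ord[OF Ord_top] Vlevel_iff[of "\<pi> x" \<kappa>] by blast
qed

text \<open>By induction on x, equal collapses force x and y to have the same members in
  \<open>H\<close>, and \<open>H\<close> is extensional.\<close>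

lemma coll_inj: "x \<in> H \<Longrightarrow> y \<in> H \<Longrightarrow> \<pi> x = \<pi> y \<Longrightarrow> x = y"
proof (induction x arbitrary: y rule: elts_induct)
  case (step x)
  have eq: "\<pi> ` (elts x \<inter> H) = \<pi> ` (elts y \<inter> H)" using elts_coll step(2-4) by metis
  have "elts x \<inter> H = elts y \<inter> H"
  proof
    show "elts x \<inter> H \<subseteq> elts y \<inter> H"
    proof
      fix u assume u: "u \<in> elts x \<inter> H"
      then obtain v where "v \<in> elts y \<inter> H" "\<pi> u = \<pi> v" using eq by blast
      then show "u \<in> elts y \<inter> H" using step(1)[of u v] u by blast
    qed
    show "elts y \<inter> H \<subseteq> elts x \<inter> H"
    proof
      fix v assume v: "v \<in> elts y \<inter> H"
      then have "\<pi> v \<in> \<pi> ` (elts x \<inter> H)" using eq by blast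
      then obtain u where "u \<in> elts x \<inter> H" "\<pi> u = \<pi> v" by auto
      then show "v \<in> elts x \<inter> H" using step(1)[of u v] v by blast
    qed
  qed
  then show ?case using H_ext step(2,3) by blast
qed

lemma inj_on_coll: "inj_on \<pi> H"
  using coll_inj by (intro inj_onI)

lemma coll_mem_iff:
  assumes "x \<in> H" "y \<in> H" shows "x \<in> elts y \<longleftrightarrow> \<pi> x \<in> elts (\<pi> y)"
proof
  assume "\<pi> x \<in> elts (\<pi> y)"
  then obtain u where "u \<in> elts y \<inter> H" "\<pi> x = \<pi> u" using elts_coll[OF assms(2)] by blast
  then show "x \<in> elts y" using coll_inj[of x u] assms(1) by blast
qed (use elts_coll[OF assms(2)] assms(1) in blast)

lemma collapsed_set_ex: obtains M where "elts M = \<pi> ` H"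
proof -
  obtain v where "elts v = Vlevel \<kappa>" using levels[OF Ord_top] by blast
  then show thesis using separation[of "\<pi> ` H" v] coll_in that by blast
qed

lemma Ord_coll: "x \<in> H \<Longrightarrow> Ord x \<Longrightarrow> Ord (\<pi> x)"
proof (induction x rule: elts_induct)
  case (step x)
  have *: "Ord u" if u: "u \<in> elts (\<pi> x)" for u
  proof -
    obtain y where "y \<in> elts x" "y \<in> H" "u = \<pi> y" using u elts_coll[OF step(2)] by blast
    then show ?thesis using step(1)[of y] Ord_in_Ord[OF step(3)] by blast
  qed
  have "transitive (\<pi> x)"
    unfolding transitive_def
  proof
    fix u assume "u \<in> elts (\<pi> x)"
    then obtain y where y: "y \<in> elts x" "y \<in> H" "u = \<pi> y" using elts_coll[OF step(2)] by blast
    have "elts y \<subseteq> elts x" using y(1) Ord_trans[OF step(3)] by blast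
    then show "elts u \<subseteq> elts (\<pi> x)" using elts_coll[OF step(2)] elts_coll[OF y(2)] y(3) by blast
  qed
  then show ?case using * unfolding Ord_def by (metis (no_types))
qed

end

section \<open>Absoluteness of cardinals\<close>

text \<open>Only the relation \<open>R\<close> coded by f matters: the uniqueness clauses of
  \<open>bij_in\<close> make it a one-to-one correspondence once \<open>A\<close> contains all
  elements of \<alpha> and \<beta>.\<close>

lemma bij_in_imp_eqpoll:
  assumes "bij_in A f \<alpha> \<beta>" "elts \<alpha> \<subseteq> A" "elts \<beta> \<subseteq> A"
  shows "elts \<alpha> \<approx> elts (\<beta>::'v::set_universe)"
proof -
  define R where "R x y \<longleftrightarrow> (\<exists>p\<in>A. p \<in> elts f \<and> pair_in A x y p)" for x y
  note bij = assms(1)[unfolded bij_in_def, folded R_def]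
  have 1: "\<exists>!y. y \<in> elts \<beta> \<and> R x y" if "x \<in> elts \<alpha>" for x
  proof -
    have "\<exists>!y. y \<in> A \<and> y \<in> elts \<beta> \<and> R x y"
      by (rule bij[THEN conjunct2, THEN conjunct1, rule_format]) (use assms(2) that in auto)
    moreover have "(y \<in> A \<and> y \<in> elts \<beta> \<and> R x y) = (y \<in> elts \<beta> \<and> R x y)" for y
      using assms(3) by blast
    ultimately show ?thesis by simp
  qed
  have 2: "\<exists>!x. x \<in> elts \<alpha> \<and> R x y" if "y \<in> elts \<beta>" for y
  proof -
    have "\<exists>!x. x \<in> A \<and> x \<in> elts \<alpha> \<and> R x y"
      by (rule bij[THEN conjunct2, THEN conjunct2, rule_format]) (use assms(3) that in auto)
    moreover have "(x \<in> A \<and> x \<in> elts \<alpha> \<and> R x y) = (x \<in> elts \<alpha> \<and> R x y)" for x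
      using assms(2) by blast
    ultimately show ?thesis by simp
  qed
  define g where "g x = (THE y. y \<in> elts \<beta> \<and> R x y)" for x
  have g: "g x \<in> elts \<beta> \<and> R x (g x)" if "x \<in> elts \<alpha>" for x
    unfolding g_def by (rule theI'[OF 1[OF that]])
  have "bij_betw g (elts \<alpha>) (elts \<beta>)"
  proof (rule bij_betwI')
    show "g x = g y \<longleftrightarrow> x = y" if "x \<in> elts \<alpha>" "y \<in> elts \<alpha>" for x y
      using g[OF that(1)] g[OF that(2)] 2[of "g x"] that by auto
    show "g x \<in> elts \<beta>" if "x \<in> elts \<alpha>" for x using g that by blast
    show "\<exists>x\<in>elts \<alpha>. y = g x" if y: "y \<in> elts \<beta>" for y
    proof -
      obtain x where x: "x \<in> elts \<alpha>" "R x y" using 2[OF y] by blast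
      then have "y = g x" using g[OF x(1)] 1[OF x(1)] y by blast
      then show ?thesis using x by blast
    qed
  qed
  then show ?thesis unfolding eqpoll_def by blast
qed

lemma ord_in_Ord: "Ord \<alpha> \<Longrightarrow> ord_in A (\<alpha>::'v::set_universe)"
  unfolding ord_in_def Ord_def transitive_def by blast

lemma ord_in_imp_Ord:
  assumes "\<And>x. x \<in> A \<Longrightarrow> elts x \<subseteq> A" "\<alpha> \<in> A" "ord_in A \<alpha>" shows "Ord (\<alpha>::'v::set_universe)"
proof -
  have "transitive \<alpha>"
    using assms(1)[OF assms(2)] assms(1,3) unfolding ord_in_def transitive_def by (meson subset_eq)
  moreover have "transitive x" if "x \<in> elts \<alpha>" for x
  proof -
    have x: "x \<in> A" using that assms(1)[OF assms(2)] by blast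
    have "z \<in> elts x" if "y \<in> elts x" "z \<in> elts y" for y z
      using assms(1)[OF x] assms(1)[of y] assms(3) x \<open>x \<in> elts \<alpha>\<close> that unfolding ord_in_def by (meson subsetD)
    then show ?thesis unfolding transitive_def by blast
  qed
  ultimately show ?thesis unfolding Ord_def by (metis (no_types))
qed

text \<open>A bijection seen by a transitive \<open>A\<close> is a real one, so \<open>A\<close>
  cannot collapse a true cardinal.\<close>

lemma Card_imp_card_in:
  assumes "\<And>x. x \<in> A \<Longrightarrow> elts x \<subseteq> A" "\<mu> \<in> A" "Card \<mu>"
  shows "card_in A (\<mu>::'v::set_universe)"
  unfolding card_in_def
proof (intro conjI notI)
  show "ord_in A \<mu>" using assms Card_imp_Ord ord_in_Ord by blast
  assume "\<exists>\<beta>\<in>A. \<beta> \<in> elts \<mu> \<and> (\<exists>f\<in>A. bij_in A f \<beta> \<mu>)"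
  then obtain \<beta> f where "\<beta> \<in> A" "\<beta> \<in> elts \<mu>" "bij_in A f \<beta> \<mu>" by blast
  then have "elts \<beta> \<approx> elts \<mu>" using bij_in_imp_eqpoll assms by blast
  then show False using assms(3) \<open>\<beta> \<in> elts \<mu>\<close> unfolding Card_def by blast
qed

locale limit_level =
  fixes \<kappa> :: "'v::set_universe"
  assumes Ord_limit: "Ord \<kappa>" and limit: "\<xi> \<in> elts \<kappa> \<Longrightarrow> \<exists>\<eta>\<in>elts \<kappa>. \<xi> \<in> elts \<eta>"
begin

lemma level_trans: "x \<in> Vlevel \<kappa> \<Longrightarrow> elts x \<subseteq> Vlevel \<kappa>"
  using Vlevel_subset Ord_limit by blast

lemma set_in_level:
  assumes "\<xi> \<in> elts \<kappa>" "X \<subseteq> Vlevel \<xi>" shows "\<exists>z\<in>Vlevel \<kappa>. elts z = X"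
proof -
  obtain v where "elts v = Vlevel \<xi>" using levels Ord_in_Ord[OF Ord_limit assms(1)] by blast
  then obtain z where "elts z = X" using separation[of X v] assms(2) by blast
  then show ?thesis using assms Vlevel_iff[of z \<kappa>] by blast
qed

definition upair :: "'v \<Rightarrow> 'v \<Rightarrow> 'v" where "upair x y = (SOME p. elts p = {x, y})"

lemma elts_upair [simp]: "elts (upair x y) = {x, y}"
  unfolding upair_def by (rule someI_ex[OF pairing])

lemma upair_level:
  assumes "\<xi> \<in> elts \<eta>" "x \<in> Vlevel \<xi>" "y \<in> Vlevel \<xi>"
  shows "upair x y \<in> Vlevel \<eta>"
  using assms Vlevel_iff[of "upair x y" \<eta>] by auto

definition opair :: "'v \<Rightarrow> 'v \<Rightarrow> 'v" where "opair x y = upair (upair x x) (upair x y)"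

lemma opair_inject: "opair x y = opair u v \<longleftrightarrow> x = u \<and> y = v"
proof
  assume "opair x y = opair u v"
  then have "{upair x x, upair x y} = {upair u u, upair u v}" unfolding opair_def by (metis elts_upair)
  moreover have upair_eq: "upair a b = upair c d \<longleftrightarrow> {a, b} = {c, d}" for a b c d :: 'v
    using elts_upair extensionality by metis
  ultimately show "x = u \<and> y = v" by (auto simp: doubleton_eq_iff upair_eq)
qed simp

lemma upair_in_level:
  "z \<in> Vlevel \<kappa> \<Longrightarrow> x \<in> Vlevel \<kappa> \<Longrightarrow> y \<in> Vlevel \<kappa> \<Longrightarrow> upair_in (Vlevel \<kappa>) x y z \<longleftrightarrow> z = upair x y"
proof
  assume z: "z \<in> Vlevel \<kappa>" and xy: "x \<in> Vlevel \<kappa>" "y \<in> Vlevel \<kappa>"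
  assume "upair_in (Vlevel \<kappa>) x y z"
  then have "elts z = {x, y}" using level_trans[OF z] xy unfolding upair_in_def by blast
  then show "z = upair x y" using extensionality elts_upair by metis
qed (simp add: upair_in_def)

lemma upair_closed:
  assumes "x \<in> Vlevel \<kappa>" "y \<in> Vlevel \<kappa>" shows "upair x y \<in> Vlevel \<kappa>"
proof -
  obtain \<xi> \<eta> where *: "\<xi> \<in> elts \<kappa>" "elts x \<subseteq> Vlevel \<xi>" "\<eta> \<in> elts \<kappa>" "elts y \<subseteq> Vlevel \<eta>"
    using assms Vlevel_iff by metis
  have O: "Ord \<xi>" "Ord \<eta>" using * Ord_in_Ord[OF Ord_limit] by blast+
  obtain \<zeta> where "\<zeta> \<in> elts \<kappa>" "elts x \<subseteq> Vlevel \<zeta>" "elts y \<subseteq> Vlevel \<zeta>"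
    using * Ord_linear[OF O] Vlevel_mono O by (metis subset_trans)
  moreover obtain \<theta> where "\<theta> \<in> elts \<kappa>" "\<zeta> \<in> elts \<theta>" using limit calculation(1) by blast
  ultimately show ?thesis using Vlevel_iff[of x \<theta>] Vlevel_iff[of y \<theta>]
      Vlevel_iff[of "upair x y" \<kappa>] by auto
qed

lemma pair_in_level:
  assumes "x \<in> Vlevel \<kappa>" "y \<in> Vlevel \<kappa>" "p \<in> Vlevel \<kappa>"
  shows "pair_in (Vlevel \<kappa>) x y p \<longleftrightarrow> p = opair x y"
  unfolding pair_in_def opair_def using assms upair_in_level upair_closed by metis

text \<open>A bijection collapsing \<mu> is a set of pairs of ordinals below \<mu>, so it already
  belongs to the level at the limit \<kappa>.\<close>

lemma card_in_level_imp_Card: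
  assumes "\<mu> \<in> Vlevel \<kappa>" "card_in (Vlevel \<kappa>) \<mu>" shows "Card \<mu>"
proof -
  let ?A = "Vlevel \<kappa>"
  have O: "Ord \<mu>" using ord_in_imp_Ord[of ?A \<mu>] assms level_trans unfolding card_in_def by blast
  have \<mu>\<kappa>: "\<mu> \<in> elts \<kappa>" using Ord_in_Vlevel[OF O Ord_limit assms(1)] .
  have "\<not> elts \<beta> \<approx> elts \<mu>" if \<beta>: "\<beta> \<in> elts \<mu>" for \<beta>
  proof
    assume "elts \<beta> \<approx> elts \<mu>"
    then obtain g where g: "bij_betw g (elts \<beta>) (elts \<mu>)" unfolding eqpoll_def by blast
    \<comment> \<open>A Kuratowski pair is two unordered pairs deep and each costs one level, hence
      two further ordinals above \<mu>.\<close>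
    obtain \<eta> where \<eta>: "\<eta> \<in> elts \<kappa>" "\<mu> \<in> elts \<eta>" using limit \<mu>\<kappa> by blast
    obtain \<zeta> where \<zeta>: "\<zeta> \<in> elts \<kappa>" "\<eta> \<in> elts \<zeta>" using limit \<eta> by blast
    have \<mu>V: "elts \<mu> \<subseteq> Vlevel \<mu>" using Ord_subset_Vlevel O by blast
    have sub: "elts \<beta> \<subseteq> elts \<mu>" using \<beta> Ord_trans[OF O] by blast
    have gin: "g x \<in> elts \<mu>" if "x \<in> elts \<beta>" for x using g that by (auto simp: bij_betw_def)
    have "(\<lambda>x. opair x (g x)) ` elts \<beta> \<subseteq> Vlevel \<zeta>"
    proof
      fix p assume "p \<in> (\<lambda>x. opair x (g x)) ` elts \<beta>"
      then obtain x where x: "x \<in> elts \<beta>" "p = opair x (g x)" by blast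
      then have "x \<in> Vlevel \<mu>" "g x \<in> Vlevel \<mu>" using \<mu>V sub gin by blast+
      then show "p \<in> Vlevel \<zeta>" unfolding x(2) opair_def using upair_level \<eta>(2) \<zeta>(2) by blast
    qed
    from set_in_level[OF \<zeta>(1) this] obtain f
      where f: "f \<in> ?A" "elts f = (\<lambda>x. opair x (g x)) ` elts \<beta>" by blast
    have \<beta>A: "\<beta> \<in> ?A" using \<beta> level_trans[OF assms(1)] by blast
    have sA: "elts \<beta> \<subseteq> ?A" "elts \<mu> \<subseteq> ?A" using level_trans \<beta>A assms(1) by blast+
    have R: "(\<exists>p\<in>?A. p \<in> elts f \<and> pair_in ?A x y p) \<longleftrightarrow> x \<in> elts \<beta> \<and> y = g x"
      if "x \<in> ?A" "y \<in> ?A" for x y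
    proof -
      have "(\<exists>p\<in>?A. p \<in> elts f \<and> pair_in ?A x y p) \<longleftrightarrow> opair x y \<in> elts f"
        using pair_in_level[OF that] level_trans[OF f(1)] by blast
      then show ?thesis unfolding f(2) using opair_inject by auto
    qed
    have "bij_in ?A f \<beta> \<mu>"
      unfolding bij_in_def
    proof (intro conjI ballI impI)
      fix p assume "p \<in> ?A" "p \<in> elts f"
      moreover obtain x where x: "x \<in> elts \<beta>" "p = opair x (g x)" using \<open>p \<in> elts f\<close> f(2) by blast
      moreover have "x \<in> ?A" "g x \<in> ?A" using x gin sA by blast+
      ultimately show "\<exists>x\<in>?A. \<exists>y\<in>?A. x \<in> elts \<beta> \<and> y \<in> elts \<mu> \<and> pair_in ?A x y p"
        using pair_in_level[of x "g x" p] gin by blast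
    next
      fix x assume "x \<in> ?A" "x \<in> elts \<beta>"
      then show "\<exists>!y. y \<in> ?A \<and> y \<in> elts \<mu> \<and> (\<exists>p\<in>?A. p \<in> elts f \<and> pair_in ?A x y p)"
        using R[OF \<open>x \<in> ?A\<close>] gin[of x] sA(2) by (intro ex1I[of _ "g x"]) auto
    next
      fix y assume y: "y \<in> ?A" "y \<in> elts \<mu>"
      then have "y \<in> g ` elts \<beta>" using bij_betw_imp_surj_on[OF g] by simp
      then obtain x where x: "x \<in> elts \<beta>" "g x = y" by auto
      show "\<exists>!x. x \<in> ?A \<and> x \<in> elts \<beta> \<and> (\<exists>p\<in>?A. p \<in> elts f \<and> pair_in ?A x y p)"
      proof (intro ex1I[of _ x] conjI)
        show "x \<in> ?A" "x \<in> elts \<beta>" using x(1) sA(1) by blast+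
        then show "\<exists>p\<in>?A. p \<in> elts f \<and> pair_in ?A x y p" using R[OF _ y(1), of x] x by blast
        fix z assume z: "z \<in> ?A \<and> z \<in> elts \<beta> \<and> (\<exists>p\<in>?A. p \<in> elts f \<and> pair_in ?A z y p)"
        then have "y = g z" using R[OF _ y(1), of z] by blast
        then show "z = x" using bij_betw_imp_inj_on[OF g] z x unfolding inj_on_def by blast
      qed
    qed
    then have "\<exists>\<beta>\<in>?A. \<beta> \<in> elts \<mu> \<and> (\<exists>f\<in>?A. bij_in ?A f \<beta> \<mu>)" using \<beta>A \<beta> f(1) by blast
    then show False using assms(2) unfolding card_in_def by (elim conjE notE)
  qed
  then show ?thesis using O unfolding Card_def by blast
qed

end

text \<open>In the formulas defining \<open>card_in\<close>, the variables \<open>0, 1, 2\<close> stand for \<open>\<mu>, \<beta>, f\<close>; the variables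
  from \<open>20\<close> on are reserved for the bound variables of the pairing formulas.\<close>

definition All_fm :: "nat \<Rightarrow> fm \<Rightarrow> fm" where "All_fm i \<phi> = Neg (Exists i (Neg \<phi>))"
definition Imp_fm :: "fm \<Rightarrow> fm \<Rightarrow> fm" where "Imp_fm \<phi> \<psi> = Neg (Conj \<phi> (Neg \<psi>))"
definition Or_fm :: "fm \<Rightarrow> fm \<Rightarrow> fm" where "Or_fm \<phi> \<psi> = Neg (Conj (Neg \<phi>) (Neg \<psi>))"
definition Iff_fm :: "fm \<Rightarrow> fm \<Rightarrow> fm" where "Iff_fm \<phi> \<psi> = Conj (Imp_fm \<phi> \<psi>) (Imp_fm \<psi> \<phi>)"

lemma sat_connectives [simp]:
  "sat A s (All_fm i \<phi>) \<longleftrightarrow> (\<forall>a\<in>A. sat A (s(i := a)) \<phi>)"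
  "sat A s (Imp_fm \<phi> \<psi>) \<longleftrightarrow> (sat A s \<phi> \<longrightarrow> sat A s \<psi>)"
  "sat A s (Or_fm \<phi> \<psi>) \<longleftrightarrow> sat A s \<phi> \<or> sat A s \<psi>"
  "sat A s (Iff_fm \<phi> \<psi>) \<longleftrightarrow> (sat A s \<phi> \<longleftrightarrow> sat A s \<psi>)"
  by (auto simp: All_fm_def Imp_fm_def Or_fm_def Iff_fm_def)

definition upair_fm :: "nat \<Rightarrow> nat \<Rightarrow> nat \<Rightarrow> fm" where
  "upair_fm x y p = All_fm 20 (Iff_fm (Mem 20 p) (Or_fm (Equal 20 x) (Equal 20 y)))"

definition pair_fm :: "nat \<Rightarrow> nat \<Rightarrow> nat \<Rightarrow> fm" where
  "pair_fm x y p = Exists 21 (Exists 22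
     (Conj (upair_fm x x 21) (Conj (upair_fm x y 22) (upair_fm 21 22 p))))"

definition ord_fm :: fm where
  "ord_fm = Conj
     (All_fm 1 (Imp_fm (Mem 1 0) (All_fm 2 (Imp_fm (Mem 2 1) (Mem 2 0)))))
     (All_fm 1 (Imp_fm (Mem 1 0) (All_fm 2 (Imp_fm (Mem 2 1) (All_fm 3 (Imp_fm (Mem 3 2) (Mem 3 1)))))))"

definition related_fm :: "nat \<Rightarrow> nat \<Rightarrow> fm" where
  "related_fm x y = Exists 5 (Conj (Mem 5 2) (pair_fm x y 5))"

definition bij_fm :: fm where
  "bij_fm = Conj
     (All_fm 5 (Imp_fm (Mem 5 2) (Exists 3 (Exists 4 (Conj (Mem 3 1) (Conj (Mem 4 0) (pair_fm 3 4 5)))))))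
     (Conj
       (All_fm 3 (Imp_fm (Mem 3 1) (Exists 4 (Conj (Conj (Mem 4 0) (related_fm 3 4))
          (All_fm 6 (Imp_fm (Conj (Mem 6 0) (related_fm 3 6)) (Equal 6 4)))))))
       (All_fm 4 (Imp_fm (Mem 4 0) (Exists 3 (Conj (Conj (Mem 3 1) (related_fm 3 4))
          (All_fm 6 (Imp_fm (Conj (Mem 6 1) (related_fm 6 4)) (Equal 6 3))))))))"

definition card_fm :: fm where
  "card_fm = Conj ord_fm (Neg (Exists 1 (Conj (Mem 1 0) (Exists 2 bij_fm))))"

lemma sat_upair_fm:
  "x \<noteq> 20 \<Longrightarrow> y \<noteq> 20 \<Longrightarrow> p \<noteq> 20 \<Longrightarrow> sat A s (upair_fm x y p) \<longleftrightarrow> upair_in A (s x) (s y) (s p)"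
  unfolding upair_fm_def upair_in_def by simp

lemma sat_pair_fm:
  "x < 20 \<Longrightarrow> y < 20 \<Longrightarrow> p < 20 \<Longrightarrow> sat A s (pair_fm x y p) \<longleftrightarrow> pair_in A (s x) (s y) (s p)"
  unfolding pair_fm_def pair_in_def by (simp add: sat_upair_fm)

lemma sat_related_fm:
  "x < 20 \<Longrightarrow> y < 20 \<Longrightarrow> x \<noteq> 5 \<Longrightarrow> y \<noteq> 5 \<Longrightarrow>
    sat A s (related_fm x y) \<longleftrightarrow> (\<exists>p\<in>A. p \<in> elts (s 2) \<and> pair_in A (s x) (s y) p)"
  unfolding related_fm_def by (simp add: sat_pair_fm)

lemma sat_bij_fm: "sat A s bij_fm \<longleftrightarrow> bij_in A (s 2) (s 1) (s 0)"
proof -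
  \<comment> \<open>The formulas have no unique existence quantifier; \<open>bij_fm\<close> spells
    it out as a witness to which every other solution is equal.\<close>
  have ex1: "(\<exists>!y. y \<in> A \<and> P y \<and> Q y) \<longleftrightarrow> (\<exists>y\<in>A. (P y \<and> Q y) \<and> (\<forall>z\<in>A. P z \<and> Q z \<longrightarrow> z = y))"
    for P Q :: "'a \<Rightarrow> bool" by auto
  show ?thesis
    unfolding bij_fm_def bij_in_def ex1 by (simp add: sat_pair_fm sat_related_fm)
qed

lemma sat_ord_fm: "sat A s ord_fm \<longleftrightarrow> ord_in A (s 0)"
  unfolding ord_fm_def ord_in_def by simp

lemma sat_card_fm: "sat A s card_fm \<longleftrightarrow> card_in A (s 0)"
  unfolding card_fm_def card_in_def by (simp add: sat_ord_fm sat_bij_fm)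

lemma elementary_card_in:
  assumes "elementary_embedding j A B" "\<mu> \<in> A"
  shows "card_in A \<mu> \<longleftrightarrow> card_in B (j \<mu>)"
proof -
  have "range (\<lambda>_. \<mu>) \<subseteq> A" using assms(2) by auto
  then have "sat A (\<lambda>_. \<mu>) card_fm \<longleftrightarrow> sat B (j \<circ> (\<lambda>_. \<mu>)) card_fm"
    using assms(1) unfolding elementary_embedding_def by blast
  then show ?thesis by (simp add: sat_card_fm)
qed

section \<open>Normality and indiscernibles\<close>

text \<open>If every \<xi> < \<kappa> were finite, counting the elements of \<xi> would inject
  \<kappa> into the natural numbers.\<close>

lemma (in complete_ultrafilter) infinite_below: "\<exists>\<xi>\<in>elts \<kappa>. infinite (elts \<xi>)"
proof (rule ccontr)
  assume "\<not> ?thesis"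
  then have fin: "finite (elts \<xi>)" if "\<xi> \<in> elts \<kappa>" for \<xi> using that by blast
  have less: "card (elts \<xi>) < card (elts \<eta>)" if "\<xi> \<in> elts \<eta>" "\<eta> \<in> elts \<kappa>" for \<xi> \<eta>
  proof -
    have "elts \<xi> \<subset> elts \<eta>" using that Ord_trans[OF Ord_in_kappa[OF that(2)]] mem_not_refl by blast
    then show ?thesis using psubset_card_mono fin[OF that(2)] by blast
  qed
  have "inj_on (\<lambda>\<xi>. card (elts \<xi>)) (elts \<kappa>)"
    using less Ord_linear Ord_in_kappa by (metis (no_types, lifting) inj_onI less_irrefl)
  then show False using uncountable_kappa by (auto simp: countable_def)
qed

context normal_ultrafilter
begin

text \<open>If almost every \<open>x < \<kappa>\<close> were equipotent to a smaller ordinal, this ordinal would be a fixed \<open>\<eta>\<close>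
  by normality, and amalgamating the bijections modulo the ultrafilter would inject \<open>\<kappa>\<close> into \<open>\<eta>\<close>.\<close>

lemma W_Card: "{x \<in> elts \<kappa>. Card x} \<in> W"
proof (rule ccontr)
  assume "{x \<in> elts \<kappa>. Card x} \<notin> W"
  then have *: "{x \<in> elts \<kappa>. \<not> Card x} \<in> W" by (rule W_not)
  define g where "g x = (SOME \<beta>. \<beta> \<in> elts x \<and> elts \<beta> \<approx> elts x)" for x :: 'v
  have g: "g x \<in> elts x \<and> elts (g x) \<approx> elts x" if x: "x \<in> elts \<kappa>" "\<not> Card x" for x
  proof -
    have "\<exists>\<beta>. \<beta> \<in> elts x \<and> elts \<beta> \<approx> elts x" using x Ord_in_kappa unfolding Card_def by blast
    then show ?thesis unfolding g_def by (rule someI_ex)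
  qed
  have "{x \<in> elts \<kappa>. g x \<in> elts x} \<in> W" using * by (rule W_imp) (use g in blast)
  then obtain \<eta> where \<eta>: "\<eta> \<in> elts \<kappa>" "{x \<in> elts \<kappa>. g x = \<eta>} \<in> W" using normal by blast
  have B: "{x \<in> elts \<kappa>. elts \<eta> \<approx> elts x} \<in> W"
    using W_conj[OF * \<eta>(2)] by (rule W_imp) (use g in blast)
  define h :: "'v \<Rightarrow> 'v \<Rightarrow> 'v" where "h x = (SOME h. bij_betw h (elts x) (elts \<eta>))" for x
  have h: "bij_betw (h x) (elts x) (elts \<eta>)" if "elts \<eta> \<approx> elts x" for x
  proof -
    have "\<exists>h. bij_betw h (elts x) (elts \<eta>)" using that eqpoll_sym unfolding eqpoll_def by blast
    then show ?thesis unfolding h_def by (rule someI_ex)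
  qed
  have "\<exists>v. v \<in> elts \<eta> \<and> {x \<in> elts \<kappa>. h x \<xi> = v} \<in> W" if \<xi>: "\<xi> \<in> elts \<kappa>" for \<xi>
  proof -
    have "{x \<in> elts \<kappa>. h x \<xi> \<in> elts \<eta>} \<in> W"
      using W_conj[OF B W_tail[OF \<xi>]]
    proof (rule W_imp)
      fix x assume "elts \<eta> \<approx> elts x \<and> \<xi> \<in> elts x"
      then show "h x \<xi> \<in> elts \<eta>" using h[of x] unfolding bij_betw_def by blast
    qed
    then show ?thesis using W_constant_below[OF \<eta>(1), of "\<lambda>x. h x \<xi>"] by blast
  qed
  then obtain G where G: "\<And>\<xi>. \<xi> \<in> elts \<kappa> \<Longrightarrow> G \<xi> \<in> elts \<eta> \<and> {x \<in> elts \<kappa>. h x \<xi> = G \<xi>} \<in> W"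
    by metis
  have "inj_on G (elts \<kappa>)"
  proof (rule inj_onI)
    fix \<xi> \<zeta> assume \<xi>: "\<xi> \<in> elts \<kappa>" and \<zeta>: "\<zeta> \<in> elts \<kappa>" and eq: "G \<xi> = G \<zeta>"
    have "{x \<in> elts \<kappa>. (elts \<eta> \<approx> elts x \<and> (\<xi> \<in> elts x \<and> \<zeta> \<in> elts x)) \<and> (h x \<xi> = G \<xi> \<and> h x \<zeta> = G \<zeta>)} \<in> W"
      by (intro W_conj B W_tail \<xi> \<zeta> G[THEN conjunct2])
    from W_ex[OF this] obtain x where "elts \<eta> \<approx> elts x" "\<xi> \<in> elts x" "\<zeta> \<in> elts x" "h x \<xi> = h x \<zeta>"
      using eq by auto
    then show "\<xi> = \<zeta>" using h[of x] unfolding bij_betw_def inj_on_def by blast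
  qed
  then have "elts \<kappa> \<lesssim> elts \<eta>" using G unfolding lepoll_def by blast
  then show False using less_kappa[OF \<eta>(1)] lesspoll_trans1 lesspoll_not_refl by blast
qed

text \<open>Almost all x are cardinals above a fixed infinite \<xi>. Were almost all countable, two
  of them, one above the other, would be equipotent.\<close>

lemma W_uncountable: "{x \<in> elts \<kappa>. uncountable (elts x)} \<in> W"
proof (rule ccontr)
  assume "{x \<in> elts \<kappa>. uncountable (elts x)} \<notin> W"
  then have "{x \<in> elts \<kappa>. \<not> uncountable (elts x)} \<in> W" by (rule W_not)
  moreover obtain \<xi> where \<xi>: "\<xi> \<in> elts \<kappa>" "infinite (elts \<xi>)" using infinite_below by blast
  ultimately have E: "{x \<in> elts \<kappa>. (\<not> uncountable (elts x) \<and> \<xi> \<in> elts x) \<and> Card x} \<in> W"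
    by (intro W_conj W_tail W_Card)
  obtain x where x: "x \<in> elts \<kappa>" "countable (elts x)" "\<xi> \<in> elts x" "Card x" using W_ex[OF E] by blast
  obtain y where y: "countable (elts y)" "\<xi> \<in> elts y" "Card y" "x \<in> elts y"
    using W_ex[OF W_conj[OF E W_tail[OF x(1)]]] by blast
  have inf: "infinite (elts z)" if "\<xi> \<in> elts z" "Card z" for z
  proof -
    have "elts \<xi> \<subseteq> elts z" using that Ord_trans Card_imp_Ord by blast
    then show ?thesis using \<xi>(2) finite_subset by blast
  qed
  have "elts x \<approx> (UNIV :: nat set)" "(UNIV :: nat set) \<approx> elts y"
    using x y inf by (meson countableE_infinite eqpoll_def eqpoll_sym)+
  then show False using y(3,4) eqpoll_trans unfolding Card_def by blast
qed

end

text \<open>Keeping only uncountable cardinals in \<open>D\<close> ensures that its members are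
  cardinals and lie above the critical points, which will be countable.\<close>

locale indiscernibles = normal_ultrafilter \<kappa> W for \<kappa> :: "'v::set_universe" and W +
  fixes D :: "'v set"
  assumes D_W: "D \<in> W"
    and D_Card: "x \<in> D \<Longrightarrow> Card x" and D_uncountable: "x \<in> D \<Longrightarrow> uncountable (elts x)"
    and homogeneous: "\<And>i s t. \<lbrakk>increasing s; increasing t; set s \<subseteq> D; set t \<subseteq> D; length s = length t\<rbrakk>
      \<Longrightarrow> holds (Vlevel \<kappa>) i s \<longleftrightarrow> holds (Vlevel \<kappa>) i t"

lemma (in normal_ultrafilter) indiscernibles_ex: "\<exists>D. indiscernibles \<kappa> W D"
proof -
  obtain D where D: "D \<in> W"
    "\<And>i s t. \<lbrakk>increasing s; increasing t; set s \<subseteq> D; set t \<subseteq> D; length s = length t\<rbrakk>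
      \<Longrightarrow> holds (Vlevel \<kappa>) i s \<longleftrightarrow> holds (Vlevel \<kappa>) i t"
    using homogeneous_set_ex[of "holds (Vlevel \<kappa>)"] by metis
  have W: "D \<inter> {x \<in> elts \<kappa>. Card x \<and> uncountable (elts x)} \<in> W"
    by (intro W_Int D(1) W_conj W_Card W_uncountable)
  have "indiscernibles \<kappa> W (D \<inter> {x \<in> elts \<kappa>. Card x \<and> uncountable (elts x)})"
  proof unfold_locales
    show "holds (Vlevel \<kappa>) i s \<longleftrightarrow> holds (Vlevel \<kappa>) i t"
      if "increasing s" "increasing t" "set s \<subseteq> D \<inter> {x \<in> elts \<kappa>. Card x \<and> uncountable (elts x)}"
        "set t \<subseteq> D \<inter> {x \<in> elts \<kappa>. Card x \<and> uncountable (elts x)}" "length s = length t" for i s t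
      using D(2)[OF that(1,2) _ _ that(5)] that(3,4) by simp
  qed (use W in simp_all)
  then show ?thesis by blast
qed

context indiscernibles
begin

abbreviation A where "A \<equiv> Vlevel \<kappa>"
abbreviation d where "d \<equiv> enum D"
abbreviation K where "K \<equiv> elts \<kappa>"

lemma D_K: "x \<in> D \<Longrightarrow> x \<in> K"
  using W_subset[OF D_W] by blast

lemma D_Ord: "x \<in> D \<Longrightarrow> Ord x"
  using D_K Ord_in_kappa by blast

lemma K_A: "x \<in> K \<Longrightarrow> x \<in> A"
  using Ord_subset_Vlevel[OF Ord_kappa] by blast

lemma A_nonempty: "A \<noteq> {}"
  using K_A W_nonempty[OF W_top] by blast

lemma A_trans: "x \<in> A \<Longrightarrow> elts x \<subseteq> A"
  using Vlevel_subset[OF Ord_kappa] .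

lemma d_D: "x \<in> K \<Longrightarrow> d x \<in> D"
  using enum_in[OF D_W] .

lemma d_increasing: "increasing_on K d"
  by (rule enum_increasing[OF D_W])

lemma indisc:
  assumes "finite X" "\<sigma> ` X \<subseteq> D" "\<tau> ` X \<subseteq> D" "similar_on X \<sigma> \<tau>" "\<And>k. set_tm (ts k) \<subseteq> X"
  shows "sat A (\<lambda>k. ev A \<sigma> (ts k)) \<phi> \<longleftrightarrow> sat A (\<lambda>k. ev A \<tau> (ts k)) \<phi>"
  by (rule homogeneous_imp_indiscernible[OF homogeneous D_Ord assms])

lemma indisc_mem:
  assumes "finite X" "\<sigma> ` X \<subseteq> D" "\<tau> ` X \<subseteq> D" "similar_on X \<sigma> \<tau>" "set_tm t \<subseteq> X" "set_tm u \<subseteq> X"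
  shows "ev A \<sigma> t \<in> elts (ev A \<sigma> u) \<longleftrightarrow> ev A \<tau> t \<in> elts (ev A \<tau> u)"
  using indisc[OF assms(1-4), of "\<lambda>k. if k = 0 then t else u" "Mem 0 1"] assms(5,6) by simp

lemma indisc_eq:
  assumes "finite X" "\<sigma> ` X \<subseteq> D" "\<tau> ` X \<subseteq> D" "similar_on X \<sigma> \<tau>" "set_tm t \<subseteq> X" "set_tm u \<subseteq> X"
  shows "ev A \<sigma> t = ev A \<sigma> u \<longleftrightarrow> ev A \<tau> t = ev A \<tau> u"
  using indisc[OF assms(1-4), of "\<lambda>k. if k = 0 then t else u" "Equal 0 1"] assms(5,6) by simp

lemma indisc_increasing:
  assumes "increasing_on K \<sigma>" "\<sigma> ` K \<subseteq> D" "increasing_on K \<tau>" "\<tau> ` K \<subseteq> D" "\<And>k. set_tm (ts k) \<subseteq> K"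
  shows "sat A (\<lambda>k. ev A \<sigma> (ts k)) \<phi> \<longleftrightarrow> sat A (\<lambda>k. ev A \<tau> (ts k)) \<phi>"
proof -
  \<comment> \<open>Terms whose index \<phi> cannot see are replaced by \<open>ts 0\<close>, which
    leaves finitely many variables in all.\<close>
  define us where "us k = (if k < var_bound \<phi> then ts k else ts 0)" for k
  define X where "X = (\<Union>k\<in>insert 0 {..<var_bound \<phi>}. set_tm (ts k))"
  have X: "finite X" "X \<subseteq> K" unfolding X_def using finite_set_tm assms(5) by auto
  have "sat A (\<lambda>k. ev A \<sigma> (us k)) \<phi> \<longleftrightarrow> sat A (\<lambda>k. ev A \<tau> (us k)) \<phi>"
  proof (rule indisc[OF X(1)])
    show "similar_on X \<sigma> \<tau>"
      using increasing_on_similar increasing_on_subset assms X(2) Ord_in_kappa by (metis subsetD)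
    show "set_tm (us k) \<subseteq> X" for k unfolding us_def X_def by auto
  qed (use X assms in auto)
  moreover have "sat A (\<lambda>k. ev A \<rho> (us k)) \<phi> \<longleftrightarrow> sat A (\<lambda>k. ev A \<rho> (ts k)) \<phi>" for \<rho>
    by (rule sat_cong) (simp add: us_def)
  ultimately show ?thesis by blast
qed

text \<open>The pairs \<open>(a, b)\<close> and \<open>(b, c)\<close> of assignments are similar if \<open>a, b, c\<close> agree below \<open>\<beta>\<close> and
  their values at the remaining variables form three successive blocks.\<close>

lemma consecutive_blocks:
  assumes t: "set_tm t \<subseteq> V" and V: "finite V" "V \<subseteq> K" and \<beta>: "\<beta> \<in> K"
    and inc: "increasing_on V a" "increasing_on V b" "increasing_on V c"
    and D: "a ` V \<subseteq> D" "b ` V \<subseteq> D" "c ` V \<subseteq> D"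
    and low: "\<And>y. y \<in> V \<Longrightarrow> y \<in> elts \<beta> \<Longrightarrow> a y = b y \<and> b y = c y"
    and high: "\<And>y z. y \<in> V \<Longrightarrow> z \<in> V \<Longrightarrow> y \<notin> elts \<beta> \<Longrightarrow> z \<notin> elts \<beta> \<Longrightarrow> a y \<in> elts (b z) \<and> b y \<in> elts (c z)"
  shows "ev A a t = ev A b t \<longleftrightarrow> ev A b t = ev A c t"
proof -
  have OV: "Ord y" if "y \<in> V" for y using that V(2) Ord_in_kappa by blast
  note ia = increasing_on_iff[OF inc(1) OV] and ib = increasing_on_iff[OF inc(2) OV]
    and ic = increasing_on_iff[OF inc(3) OV]
  have 1: "a y \<in> elts (b z) \<longleftrightarrow> b y \<in> elts (c z)" if "y \<in> V" "z \<in> V" for y z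
    using that low[of y] low[of z] high[of y z] ia[of y z] ib[of y z] ic[of y z]
    by (cases "y \<in> elts \<beta>"; cases "z \<in> elts \<beta>") auto
  have 2: "b y \<in> elts (a z) \<longleftrightarrow> c y \<in> elts (b z)" if "y \<in> V" "z \<in> V" for y z
    using that low[of y] low[of z] high[of z y] ia[of y z] ib[of y z] ic[of y z] mem_asym
    by (cases "y \<in> elts \<beta>"; cases "z \<in> elts \<beta>") auto
  \<comment> \<open>A pair of assignments of \<open>V\<close> is one assignment of the disjoint sum
    of two copies of \<open>V\<close>, so comparing a term under both becomes comparing two terms
    under one.\<close>
  have sim: "similar_on (V <+> V) (case_sum a b) (case_sum b c)"
    unfolding similar_on_def using ia ib ic 1 2 by auto
  have img: "case_sum f g ` (V <+> V) \<subseteq> D" if "f ` V \<subseteq> D" "g ` V \<subseteq> D" for f g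
    using that by auto
  have "ev A (case_sum f g) (map_tm Inl t) = ev A f t" "ev A (case_sum f g) (map_tm Inr t) = ev A g t" for f g
    by (simp_all add: ev_map_tm comp_def)
  moreover have "ev A (case_sum a b) (map_tm Inl t) = ev A (case_sum a b) (map_tm Inr t) \<longleftrightarrow>
      ev A (case_sum b c) (map_tm Inl t) = ev A (case_sum b c) (map_tm Inr t)"
    by (rule indisc_eq[OF _ img[OF D(1,2)] img[OF D(2,3)] sim]) (use t V(1) in \<open>auto simp: tm.set_map\<close>)
  ultimately show ?thesis by simp
qed

text \<open>It turns d \<beta> into a parameter x and lifts the later indiscernibles above x, so
  that the value of a term becomes a function of x to which normality applies.\<close>

definition jump :: "'v \<Rightarrow> 'v \<Rightarrow> 'v \<Rightarrow> 'v" where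
  "jump \<beta> x y = (if y \<in> elts \<beta> then d y else if y = \<beta> then x else enum (D \<inter> {z \<in> K. x \<in> elts z}) y)"

lemma jump:
  assumes \<beta>: "\<beta> \<in> K" and x: "x \<in> D" "x = d \<beta> \<or> d \<beta> \<in> elts x"
  shows jump_D: "y \<in> K \<Longrightarrow> jump \<beta> x y \<in> D"
    and jump_low: "y \<in> elts \<beta> \<Longrightarrow> jump \<beta> x y = d y"
    and jump_at: "jump \<beta> x \<beta> = x"
    and jump_high: "y \<in> K \<Longrightarrow> y \<notin> elts \<beta> \<Longrightarrow> jump \<beta> x y = x \<or> x \<in> elts (jump \<beta> x y)"
    and jump_increasing: "increasing_on K (jump \<beta> x)"
proof -
  let ?B = "D \<inter> {z \<in> K. x \<in> elts z}"
  have B: "?B \<in> W" using W_Int[OF D_W W_tail[OF D_K[OF x(1)]]] .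
  have BD: "enum ?B y \<in> D \<and> x \<in> elts (enum ?B y)" if "y \<in> K" for y using enum_in[OF B that] by blast
  show D: "jump \<beta> x y \<in> D" if "y \<in> K" for y
    using that BD d_D x(1) unfolding jump_def by simp
  show low: "y \<in> elts \<beta> \<Longrightarrow> jump \<beta> x y = d y" for y unfolding jump_def by simp
  show "jump \<beta> x \<beta> = x" unfolding jump_def by simp
  show high: "y \<in> K \<Longrightarrow> y \<notin> elts \<beta> \<Longrightarrow> jump \<beta> x y = x \<or> x \<in> elts (jump \<beta> x y)" for y
    unfolding jump_def using BD by simp
  show "increasing_on K (jump \<beta> x)"
    unfolding increasing_on_def
  proof (intro ballI impI)
    fix y z assume yz: "y \<in> K" "z \<in> K" "y \<in> elts z"
    consider "z \<in> elts \<beta>" | "z \<notin> elts \<beta>" "y \<in> elts \<beta>" | "z \<notin> elts \<beta>" "y \<notin> elts \<beta>" by blast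
    then show "jump \<beta> x y \<in> elts (jump \<beta> x z)"
    proof cases
      case 1
      then have "y \<in> elts \<beta>" using yz(3) Ord_trans[OF Ord_in_kappa[OF \<beta>]] by blast
      then show ?thesis using 1 low enum_less[OF D_W yz(2,3)] by simp
    next
      case 2
      have "d y \<in> elts x"
        using enum_less[OF D_W \<beta> 2(2)] x Ord_trans[OF D_Ord[OF x(1)]] by blast
      then show ?thesis
        using high[OF yz(2) 2(1)] low[OF 2(2)] Ord_trans[OF D_Ord[OF D[OF yz(2)]]] by auto
    next
      case 3
      then have "\<beta> = y \<or> \<beta> \<in> elts y" using Ord_linear Ord_in_kappa \<beta> yz(1) by blast
      then have "\<beta> \<in> elts z" using yz(3) Ord_trans[OF Ord_in_kappa[OF yz(2)]] by blast
      then have "z \<noteq> \<beta>" by auto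
      then show ?thesis using 3 BD[OF yz(2)] enum_less[OF B yz(2,3)] unfolding jump_def by simp
    qed
  qed
qed

text \<open>The value of \<open>t\<close> under \<open>jump \<beta> x\<close> is a regressive function of \<open>x\<close>, hence constant on a set in \<open>W\<close>;
  members of this set that are far enough apart yield consecutive blocks with equal values.\<close>

lemma regressive_term:
  assumes \<beta>: "\<beta> \<in> K" and t: "set_tm t \<subseteq> K" "ev A d t \<in> elts (d \<beta>)"
    and \<sigma>: "increasing_on (set_tm t) \<sigma>" "\<sigma> ` set_tm t \<subseteq> D"
    and low: "\<And>y. y \<in> set_tm t \<Longrightarrow> y \<in> elts \<beta> \<Longrightarrow> \<sigma> y = d y"
  shows "ev A \<sigma> t = ev A d t"
proof -
  define E0 where "E0 = D \<inter> {x \<in> K. d \<beta> \<in> elts x}"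
  have E0: "E0 \<in> W" unfolding E0_def using W_Int[OF D_W W_tail[OF enum_in_kappa[OF D_W \<beta>]]] .
  have E0D: "x \<in> D \<and> (x = d \<beta> \<or> d \<beta> \<in> elts x)" if "x \<in> E0" for x using that unfolding E0_def by blast
  define g where "g x = ev A (jump \<beta> x) t" for x
  have reg: "g x \<in> elts x" if "x \<in> E0" for x
  proof -
    note j = E0D[OF that, THEN conjunct1] E0D[OF that, THEN conjunct2]
    let ?X = "insert \<beta> (set_tm t)"
    have XK: "?X \<subseteq> K" using t(1) \<beta> by blast
    have "similar_on ?X d (jump \<beta> x)"
      using increasing_on_similar[OF increasing_on_subset[OF d_increasing XK]
          increasing_on_subset[OF jump_increasing[OF \<beta> j] XK]] XK Ord_in_kappa by blast
    \<comment> \<open>The hypothesis compares t with the term \<open>Var\<close> \<beta>;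
      indiscernibility carries it from d to the jump, where that variable has value x.\<close>
    then have "ev A d t \<in> elts (ev A d (Var \<beta>)) \<longleftrightarrow> ev A (jump \<beta> x) t \<in> elts (ev A (jump \<beta> x) (Var \<beta>))"
      by (rule indisc_mem[rotated 3]) (use finite_set_tm[of t] XK d_D jump_D[OF \<beta> j] in auto)
    then show ?thesis using t(2) jump_at[OF \<beta> j] unfolding g_def by simp
  qed
  have "{x \<in> K. g x \<in> elts x} \<in> W" 
  proof (rule W_mono[OF E0])
    show "E0 \<subseteq> {x \<in> K. g x \<in> elts x}" using reg D_K E0D by blast
  qed blast
  then obtain v where "{x \<in> K. g x = v} \<in> W" using normal by blast
  then have E: "E0 \<inter> {x \<in> K. g x = v} \<in> W" using W_Int E0 by blast
  have above: "\<exists>x. x \<in> E0 \<and> g x = v \<and> (\<forall>y\<in>set_tm t. \<rho> y \<in> elts x)" if "\<rho> ` set_tm t \<subseteq> D" for \<rho>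
  proof -
    have "{x \<in> K. \<forall>y\<in>set_tm t. \<rho> y \<in> elts x} \<in> W"
    proof (rule W_INT)
      show "set_tm t \<prec> K" using countable_less_kappa countable_finite finite_set_tm by blast
      show "{x \<in> K. \<rho> y \<in> elts x} \<in> W" if "y \<in> set_tm t" for y
        using W_tail D_K that \<open>\<rho> ` set_tm t \<subseteq> D\<close> by blast
    qed
    from W_nonempty[OF W_Int[OF E this]] show ?thesis by blast
  qed
  \<comment> \<open>Proved for every assignment that agrees with d below \<beta>, then applied both
    to \<sigma> and to d itself.\<close>
  have "ev A \<rho> t = v" if \<rho>: "increasing_on (set_tm t) \<rho>" "\<rho> ` set_tm t \<subseteq> D"
    "\<And>y. y \<in> set_tm t \<Longrightarrow> y \<in> elts \<beta> \<Longrightarrow> \<rho> y = d y" for \<rho>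
  proof -
    obtain x where x: "x \<in> E0" "g x = v" "\<forall>y\<in>set_tm t. \<rho> y \<in> elts x" using above[OF \<rho>(2)] by blast
    note jx = E0D[OF x(1), THEN conjunct1] E0D[OF x(1), THEN conjunct2]
    have jxD: "jump \<beta> x ` set_tm t \<subseteq> D" using jump_D[OF \<beta> jx] t(1) by blast
    \<comment> \<open>With x above \<rho> and x' above the jump at x there are three successive
      blocks. The last two give the value v, hence so does \<rho>.\<close>
    obtain x' where x': "x' \<in> E0" "g x' = v" "\<forall>y\<in>set_tm t. jump \<beta> x y \<in> elts x'" using above[OF jxD] by blast
    note jx' = E0D[OF x'(1), THEN conjunct1] E0D[OF x'(1), THEN conjunct2]
    have up: "u \<in> elts (jump \<beta> z y)" if "u \<in> elts z" "z \<in> D" "z = d \<beta> \<or> d \<beta> \<in> elts z" "y \<in> set_tm t" "y \<notin> elts \<beta>" for u z y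
    proof -
      have y: "y \<in> K" using that(4) t(1) by blast
      show ?thesis using jump_high[OF \<beta> that(2,3) y that(5)] that(1)
          Ord_trans[OF D_Ord[OF jump_D[OF \<beta> that(2,3) y]]] by auto
    qed
    have "ev A \<rho> t = ev A (jump \<beta> x) t \<longleftrightarrow> ev A (jump \<beta> x) t = ev A (jump \<beta> x') t"
    proof (rule consecutive_blocks[OF subset_refl finite_set_tm t(1) \<beta> \<rho>(1) _ _ \<rho>(2) jxD])
      show "increasing_on (set_tm t) (jump \<beta> x)" "increasing_on (set_tm t) (jump \<beta> x')"
        using increasing_on_subset jump_increasing \<beta> jx jx' t(1) by blast+
      show "jump \<beta> x' ` set_tm t \<subseteq> D" using jump_D[OF \<beta> jx'] t(1) by blast
      show "\<rho> y = jump \<beta> x y \<and> jump \<beta> x y = jump \<beta> x' y" if "y \<in> set_tm t" "y \<in> elts \<beta>" for y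
        using \<rho>(3) that jump_low[OF \<beta> jx] jump_low[OF \<beta> jx'] by simp
      show "\<rho> y \<in> elts (jump \<beta> x z) \<and> jump \<beta> x y \<in> elts (jump \<beta> x' z)"
        if "y \<in> set_tm t" "z \<in> set_tm t" "y \<notin> elts \<beta>" "z \<notin> elts \<beta>" for y z
        using that x(3) x'(3) up jx jx' by blast
    qed
    then show ?thesis using x(2) x'(2) unfolding g_def by simp
  qed
  note const = this
  have "ev A \<sigma> t = v" by (rule const[OF \<sigma> low])
  moreover have "ev A d t = v"
    by (rule const[OF increasing_on_subset[OF d_increasing t(1)]]) (use d_D t(1) in auto)
  ultimately show ?thesis by simp
qed

text \<open>Some \<gamma> < \<theta> exceeds all variables of t below \<theta>. Variables from
  \<theta> on can be lifted without changing the value of t, which frees d \<theta> as a value for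
  \<gamma>. The value is then below that of \<gamma>, and indiscernibility returns this fact to
  d.\<close>

lemma hull_continuous:
  assumes \<theta>: "\<theta> \<in> K" "elts \<theta> \<noteq> {}" "\<And>\<xi>. \<xi> \<in> elts \<theta> \<Longrightarrow> \<exists>\<eta>\<in>elts \<theta>. \<xi> \<in> elts \<eta>"
    and t: "set_tm t \<subseteq> K" "ev A d t \<in> elts (d \<theta>)"
  shows "\<exists>\<gamma>\<in>elts \<theta>. ev A d t \<in> elts (d \<gamma>)"
proof -
  obtain \<gamma> where \<gamma>: "\<gamma> \<in> elts \<theta>" "set_tm t \<inter> elts \<theta> \<subseteq> elts \<gamma>"
    using Ord_finite_bound[OF Ord_in_kappa[OF \<theta>(1)] \<theta>(2,3), of "set_tm t \<inter> elts \<theta>"] finite_set_tm by blast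
  have \<gamma>K: "\<gamma> \<in> K" using \<gamma> below_kappa \<theta>(1) by blast
  have \<gamma>t: "\<gamma> \<notin> set_tm t" using \<gamma> by auto
  obtain x where x: "x \<in> D" "d \<theta> \<in> elts x"
    using W_nonempty[OF W_Int[OF D_W W_tail[OF enum_in_kappa[OF D_W \<theta>(1)]]]] by blast
  note jx = x(1) disjI2[OF x(2)]
  \<comment> \<open>Since x lies above d \<theta>, the variables from \<theta> on stay above the new
    value d \<theta> of \<gamma>, while those below \<gamma> keep smaller values.\<close>
  define \<tau> where "\<tau> = (jump \<theta> x)(\<gamma> := d \<theta>)"
  let ?X = "insert \<gamma> (set_tm t)"
  have XK: "?X \<subseteq> K" using t(1) \<gamma>K by blast
  have inc: "increasing_on ?X \<tau>"
    unfolding increasing_on_def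
  proof (intro ballI impI)
    fix y z assume yz: "y \<in> ?X" "z \<in> ?X" "y \<in> elts z"
    have "y \<noteq> z" using yz(3) by auto
    then consider "y \<noteq> \<gamma>" "z \<noteq> \<gamma>" | "y = \<gamma>" "z \<noteq> \<gamma>" | "z = \<gamma>" "y \<noteq> \<gamma>" by blast
    then show "\<tau> y \<in> elts (\<tau> z)"
    proof cases
      case 1
      then show ?thesis using yz jump_increasing[OF \<theta>(1) jx] XK unfolding increasing_on_def \<tau>_def by auto
    next
      case 2
      then have z: "z \<in> set_tm t" "z \<in> K" using yz XK by auto
      have "z \<notin> elts \<theta>" using \<gamma>(2) z(1) 2 yz(3) mem_asym by blast
      then have "jump \<theta> x z = x \<or> x \<in> elts (jump \<theta> x z)" using jump_high[OF \<theta>(1) jx z(2)] by blast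
      then have "d \<theta> \<in> elts (jump \<theta> x z)"
        using x(2) Ord_trans[OF D_Ord[OF jump_D[OF \<theta>(1) jx z(2)]]] by auto
      then show ?thesis using 2 by (simp add: \<tau>_def)
    next
      case 3
      then have "y \<in> elts \<theta>" using yz(3) \<gamma>(1) Ord_trans Ord_in_kappa[OF \<theta>(1)] by blast
      then show ?thesis using 3 jump_low[OF \<theta>(1) jx] enum_less[OF D_W \<theta>(1)] by (simp add: \<tau>_def)
    qed
  qed
  have "ev A \<tau> t = ev A (jump \<theta> x) t" by (rule ev_cong) (use \<gamma>t in \<open>auto simp: \<tau>_def\<close>)
  also have "\<dots> = ev A d t"
    by (rule regressive_term[OF \<theta>(1) t])
      (use increasing_on_subset[OF jump_increasing[OF \<theta>(1) jx] t(1)] jump_D[OF \<theta>(1) jx] jump_low[OF \<theta>(1) jx] t(1) in auto)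
  finally have "ev A \<tau> t \<in> elts (ev A \<tau> (Var \<gamma>))" using t(2) by (simp add: \<tau>_def)
  moreover have "similar_on ?X \<tau> d"
    using increasing_on_similar[OF inc increasing_on_subset[OF d_increasing XK]] XK Ord_in_kappa by blast
  moreover have "\<tau> ` ?X \<subseteq> D" "d ` ?X \<subseteq> D"
    using XK d_D[OF \<theta>(1)] d_D jump_D[OF \<theta>(1) jx] by (auto simp: \<tau>_def)
  ultimately have "ev A d t \<in> elts (ev A d (Var \<gamma>))"
    using indisc_mem[of ?X \<tau> d t "Var \<gamma>"] finite_set_tm[of t] by auto
  then show ?thesis using \<gamma>(1) by auto
qed

text \<open>A value below d \<beta> survives any order-preserving renaming of the variables from
  \<beta> on. They can therefore be taken from one fixed countable set, and it remains to count
  terms.\<close>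

lemma hull_below_lepoll:
  assumes \<beta>: "\<beta> \<in> K"
  obtains Q where "countable Q" "infinite Q"
    "ev A d ` {t. set_tm t \<subseteq> K} \<inter> elts (d \<beta>) \<lesssim> elts \<beta> \<union> Q"
proof -
  have "\<forall>x. \<exists>y. x \<in> K \<longrightarrow> y \<in> K \<and> x \<in> elts y" using no_last by blast
  then obtain nx where nx: "\<And>x. x \<in> K \<Longrightarrow> nx x \<in> K \<and> x \<in> elts (nx x)" by metis
  \<comment> \<open>An increasing sequence of length \<omega> starting at \<beta>. Its infinite
    range keeps the set of variables infinite even for finite \<beta>, as
    \<open>terms_lepoll\<close> requires.\<close>
  define q where "q n = (nx ^^ n) \<beta>" for n
  have qK: "q n \<in> K" for n by (induction n) (use \<beta> nx in \<open>auto simp: q_def\<close>)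
  have q_less: "q m \<in> elts (q n)" if "m < n" for m n
    using that
  proof (induction n)
    case (Suc n)
    have "q n \<in> elts (q (Suc n))" using nx[OF qK[of n]] by (simp add: q_def)
    then show ?case using Suc Ord_trans[OF Ord_in_kappa[OF qK]] by (metis less_Suc_eq)
  qed simp
  have q_ge: "q n = \<beta> \<or> \<beta> \<in> elts (q n)" for n
    using q_less[of 0 n] by (cases n) (auto simp: q_def)
  have "inj q"
  proof (rule injI)
    fix m n assume "q m = q n"
    then show "m = n" using q_less[of m n] q_less[of n m] by (cases m n rule: linorder_cases) auto
  qed
  define Q where "Q = range q"
  have Q: "countable Q" "infinite Q" "Q \<subseteq> K"
    unfolding Q_def using \<open>inj q\<close> qK by (auto simp: finite_image_iff)
  have "ev A d ` {t. set_tm t \<subseteq> K} \<inter> elts (d \<beta>) \<subseteq> ev A d ` {t. set_tm t \<subseteq> elts \<beta> \<union> Q}"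
  proof
    fix x assume x: "x \<in> ev A d ` {t. set_tm t \<subseteq> K} \<inter> elts (d \<beta>)"
    then obtain t where t: "x = ev A d t" "set_tm t \<subseteq> K" by blast
    \<comment> \<open>Variables from \<beta> on are numbered by how many such variables precede
      them, so the least one goes to q 0 = \<beta>.\<close>
    define \<rho> where "\<rho> y = (if y \<in> elts \<beta> then y else q (card {z \<in> set_tm t. z \<notin> elts \<beta> \<and> z \<in> elts y}))" for y
    have \<rho>K: "\<rho> y \<in> K" if "y \<in> K" for y using that qK by (simp add: \<rho>_def)
    have inc: "increasing_on (set_tm t) \<rho>"
      unfolding increasing_on_def
    proof (intro ballI impI)
      fix y z assume yz: "y \<in> set_tm t" "z \<in> set_tm t" "y \<in> elts z"
      have O: "Ord z" "Ord y" using yz t(2) Ord_in_kappa by blast+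
      consider "z \<in> elts \<beta>" | "z \<notin> elts \<beta>" "y \<in> elts \<beta>" | "z \<notin> elts \<beta>" "y \<notin> elts \<beta>" by blast
      then show "\<rho> y \<in> elts (\<rho> z)"
      proof cases
        case 1
        then have "y \<in> elts \<beta>" using yz(3) Ord_trans[OF Ord_in_kappa[OF \<beta>]] by blast
        then show ?thesis using 1 yz(3) by (simp add: \<rho>_def)
      next
        case 2
        have "y \<in> elts (q n)" for n
          using q_ge[of n] Ord_trans[OF Ord_in_kappa[OF qK[of n]] 2(2)] 2(2) by auto
        then show ?thesis using 2 by (simp add: \<rho>_def)
      next
        case 3
        have "y \<in> {u \<in> set_tm t. u \<notin> elts \<beta> \<and> u \<in> elts z} - {u \<in> set_tm t. u \<notin> elts \<beta> \<and> u \<in> elts y}"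
          using yz 3 by simp
        moreover have "{u \<in> set_tm t. u \<notin> elts \<beta> \<and> u \<in> elts y} \<subseteq> {u \<in> set_tm t. u \<notin> elts \<beta> \<and> u \<in> elts z}"
          using yz(3) Ord_trans[OF O(1)] by auto
        ultimately have "{u \<in> set_tm t. u \<notin> elts \<beta> \<and> u \<in> elts y} \<subset> {u \<in> set_tm t. u \<notin> elts \<beta> \<and> u \<in> elts z}"
          by blast
        then have "card {u \<in> set_tm t. u \<notin> elts \<beta> \<and> u \<in> elts y} < card {u \<in> set_tm t. u \<notin> elts \<beta> \<and> u \<in> elts z}"
          using finite_set_tm[of t] by (intro psubset_card_mono) auto
        then show ?thesis using 3 q_less by (simp add: \<rho>_def)
      qed
    qed
    have "ev A (d \<circ> \<rho>) t = ev A d t"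
    proof (rule regressive_term[OF \<beta> t(2)])
      show "ev A d t \<in> elts (d \<beta>)" using IntD2[OF x] unfolding t(1) .
      show "increasing_on (set_tm t) (d \<circ> \<rho>)"
        using inc d_increasing \<rho>K t(2) unfolding increasing_on_def comp_apply by (meson subsetD)
      show "(d \<circ> \<rho>) ` set_tm t \<subseteq> D" using \<rho>K t(2) d_D by auto
      show "(d \<circ> \<rho>) y = d y" if "y \<in> set_tm t" "y \<in> elts \<beta>" for y using that by (simp add: \<rho>_def)
    qed
    then have "x = ev A d (map_tm \<rho> t)" using t(1) by (simp add: ev_map_tm)
    moreover have "set_tm (map_tm \<rho> t) \<subseteq> elts \<beta> \<union> Q" by (auto simp: tm.set_map \<rho>_def Q_def)
    ultimately show "x \<in> ev A d ` {t. set_tm t \<subseteq> elts \<beta> \<union> Q}" by blast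
  qed
  then have "ev A d ` {t. set_tm t \<subseteq> K} \<inter> elts (d \<beta>) \<lesssim> {t. set_tm t \<subseteq> elts \<beta> \<union> Q}"
    by (rule subset_image_lepoll)
  also have "\<dots> \<lesssim> elts \<beta> \<union> Q" using Q(2) by (intro terms_lepoll) simp
  finally show thesis using that Q(1,2) by blast
qed

end

section \<open>Embeddings of the collapsed hull\<close>

context indiscernibles
begin

abbreviation T where "T \<equiv> {t. set_tm t \<subseteq> K}"

definition H where "H = ev A d ` T"

lemma infinite_K: "infinite K"
  using uncountable_kappa uncountable_infinite by blast

lemma sat_hull:
  assumes "\<sigma> ` K \<subseteq> D" "range s \<subseteq> ev A \<sigma> ` T"
  shows "sat (ev A \<sigma> ` T) s \<phi> \<longleftrightarrow> sat A s \<phi>"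
  by (rule sat_skolem_hull[OF _ A_nonempty assms(2)]) (use assms(1) D_K K_A in blast)

lemma d_K: "d ` K \<subseteq> D"
  using d_D by blast

lemma sat_H: "range s \<subseteq> H \<Longrightarrow> sat H s \<phi> \<longleftrightarrow> sat A s \<phi>"
  unfolding H_def by (rule sat_hull[OF d_K])

lemma H_subset: "H \<subseteq> A"
proof
  fix x assume "x \<in> H"
  then obtain t where t: "x = ev A d t" "set_tm t \<subseteq> K" unfolding H_def by auto
  show "x \<in> A" unfolding t(1) by (rule ev_in[OF A_nonempty]) (use t(2) d_D D_K K_A in auto)
qed

sublocale limit_level \<kappa>
  by unfold_locales (use Ord_kappa no_last in auto)

text \<open>\<open>H\<close> is elementary in the level at \<kappa>, so agreement on members in
  \<open>H\<close> is agreement on all members.\<close>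

sublocale collapse \<kappa> H
proof unfold_locales
  show "Ord \<kappa>" by (rule Ord_kappa)
  show "H \<subseteq> A" by (rule H_subset)
  fix x y assume xy: "x \<in> H" "y \<in> H" "elts x \<inter> H = elts y \<inter> H"
  define s where "s k = (if k = 0 then x else y)" for k :: nat
  let ?ext = "All_fm 2 (Iff_fm (Mem 2 0) (Mem 2 1))"
  have "range s \<subseteq> H" using xy(1,2) by (auto simp: s_def)
  moreover have "sat H s ?ext" using xy(3) by (auto simp: s_def)
  ultimately have "sat A s ?ext" using sat_H by blast
  then have "\<forall>z\<in>A. z \<in> elts x \<longleftrightarrow> z \<in> elts y" by (simp add: s_def)
  moreover have "elts x \<subseteq> A" "elts y \<subseteq> A" using xy(1,2) H_subset A_trans by blast+
  ultimately have "elts x = elts y" by blast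
  then show "x = y" by (rule extensionality)
qed

abbreviation M where "M \<equiv> \<pi> ` H"

lemma M_trans: "x \<in> M \<Longrightarrow> elts x \<subseteq> M"
  using elts_coll by blast

lemma M_subset: "M \<subseteq> A"
  using coll_in by blast

text \<open>The number of terms over \<kappa> bounds \<open>H\<close> from above, and the distinct
  values d \<beta> bound it from below.\<close>

lemma M_eqpoll: "M \<approx> K"
proof -
  have "M \<approx> H" using inj_on_image_eqpoll_self[OF inj_on_coll] .
  moreover have "H \<approx> K"
  proof (rule lepoll_antisym)
    have "H \<lesssim> T" unfolding H_def by (rule image_lepoll)
    then show "H \<lesssim> K" using terms_lepoll[OF infinite_K] lepoll_trans by blast
    have "ev A d (Var \<beta>) \<in> H" if "\<beta> \<in> K" for \<beta> unfolding H_def using that by (intro imageI) simp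
    then show "K \<lesssim> H"
      using increasing_on_inj[OF d_increasing Ord_in_kappa] unfolding lepoll_def by auto
  qed
  ultimately show ?thesis using eqpoll_trans by blast
qed

lemma d_H: "\<beta> \<in> K \<Longrightarrow> d \<beta> \<in> H"
  unfolding H_def by (rule image_eqI[of _ _ "Var \<beta>"]) simp_all

lemma Ord_coll_d: "\<beta> \<in> K \<Longrightarrow> Ord (\<pi> (d \<beta>))"
  using Ord_coll d_H d_D D_Ord by blast

lemma elts_coll_d_lepoll:
  assumes "\<beta> \<in> K"
  obtains Q where "countable Q" "infinite Q" "elts (\<pi> (d \<beta>)) \<lesssim> elts \<beta> \<union> Q"
proof -
  obtain Q where Q: "countable Q" "infinite Q" "H \<inter> elts (d \<beta>) \<lesssim> elts \<beta> \<union> Q"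
    using hull_below_lepoll[OF assms] unfolding H_def by blast
  have "elts (\<pi> (d \<beta>)) = \<pi> ` (H \<inter> elts (d \<beta>))" using elts_coll[OF d_H[OF assms]] by (simp add: Int_commute)
  then have "elts (\<pi> (d \<beta>)) \<lesssim> H \<inter> elts (d \<beta>)" using image_lepoll by metis
  then show thesis using that Q lepoll_trans by blast
qed

text \<open>By continuity each element of \<pi> (d \<theta>) lies in some \<pi> (d \<gamma>) with
  \<gamma> < \<theta>, an ordinal of size below \<theta>. Conversely \<beta> \<mapsto> \<pi> (d
  \<beta>) is increasing, so it never falls below the identity.\<close>

lemma coll_d_Card:
  assumes \<theta>: "\<theta> \<in> K" "Card \<theta>" "uncountable (elts \<theta>)"
  shows "\<pi> (d \<theta>) = \<theta>"
proof -
  have inf: "infinite (elts \<theta>)" using \<theta>(3) uncountable_infinite by blast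
  have less: "elts (\<pi> (d \<gamma>)) \<prec> elts \<theta>" if \<gamma>: "\<gamma> \<in> elts \<theta>" for \<gamma>
  proof -
    obtain Q where Q: "countable Q" "infinite Q" "elts (\<pi> (d \<gamma>)) \<lesssim> elts \<gamma> \<union> Q"
      using elts_coll_d_lepoll below_kappa[OF \<theta>(1) \<gamma>] by blast
    \<comment> \<open>For countable \<gamma> this is uncountability of \<theta>; otherwise \<gamma>
      absorbs the countable set \<open>Q\<close>.\<close>
    have "elts \<gamma> \<union> Q \<prec> elts \<theta>"
    proof (cases "countable (elts \<gamma>)")
      case True
      then show ?thesis using Q(1) \<theta>(3) by (intro countable_lesspoll_uncountable) auto
    next
      case False
      then have "elts \<gamma> \<union> Q \<lesssim> elts \<gamma>" using Q(1) uncountable_infinite by (intro Un_countable_lepoll) auto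
      then show ?thesis using Card_lesspoll[OF \<theta>(2) \<gamma>] lesspoll_trans1 by blast
    qed
    then show ?thesis using Q(3) lesspoll_trans1 by blast
  qed
  have "elts (\<pi> (d \<theta>)) \<subseteq> elts \<theta>"
  proof
    fix u assume "u \<in> elts (\<pi> (d \<theta>))"
    then obtain x where x: "u = \<pi> x" "x \<in> H" "x \<in> elts (d \<theta>)" using elts_coll[OF d_H[OF \<theta>(1)]] by auto
    then obtain t where t: "x = ev A d t" "set_tm t \<subseteq> K" unfolding H_def by blast
    have "\<exists>\<gamma>\<in>elts \<theta>. x \<in> elts (d \<gamma>)"
      unfolding t(1)
    proof (rule hull_continuous[OF \<theta>(1) _ _ t(2)])
      show "elts \<theta> \<noteq> {}" using inf by auto
      show "\<exists>\<eta>\<in>elts \<theta>. \<xi> \<in> elts \<eta>" if "\<xi> \<in> elts \<theta>" for \<xi> using Card_limit[OF \<theta>(2) inf that] .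
      show "ev A d t \<in> elts (d \<theta>)" using x(3) unfolding t(1) .
    qed
    then obtain \<gamma> where \<gamma>: "\<gamma> \<in> elts \<theta>" "x \<in> elts (d \<gamma>)" by blast
    have \<gamma>K: "\<gamma> \<in> K" using below_kappa \<gamma>(1) \<theta>(1) by blast
    have "u \<in> elts (\<pi> (d \<gamma>))" using coll_mem_iff[OF x(2) d_H[OF \<gamma>K]] \<gamma>(2) x(1) by blast
    moreover have "\<pi> (d \<gamma>) \<in> elts \<theta>" using Card_memI[OF \<theta>(2) Ord_coll_d[OF \<gamma>K] less[OF \<gamma>(1)]] .
    ultimately show "u \<in> elts \<theta>" using Ord_trans[OF Card_imp_Ord[OF \<theta>(2)]] by blast
  qed
  moreover have "increasing_on K (\<lambda>\<beta>. \<pi> (d \<beta>))"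
    unfolding increasing_on_def using coll_mem_iff d_H enum_less[OF D_W] by blast
  then have "\<pi> (d \<theta>) = \<theta> \<or> \<theta> \<in> elts (\<pi> (d \<theta>))"
    by (rule increasing_on_ge[OF Ord_kappa]) (use Ord_coll_d \<theta>(1) in auto)
  ultimately show ?thesis using mem_not_refl by blast
qed

text \<open>Any term naming m may be chosen: by indiscernibility, terms with equal values under d
  have equal values under an increasing \<sigma> into \<open>D\<close>, as \<open>embed_term\<close>
  shows.\<close>

definition embed :: "('v \<Rightarrow> 'v) \<Rightarrow> 'v \<Rightarrow> 'v" where
  "embed \<sigma> m = ev A \<sigma> (SOME t. t \<in> T \<and> \<pi> (ev A d t) = m)"

context
  fixes \<sigma> assumes \<sigma>: "increasing_on K \<sigma>" "\<sigma> ` K \<subseteq> D"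
begin

lemma embed_term: assumes "t \<in> T" shows "embed \<sigma> (\<pi> (ev A d t)) = ev A \<sigma> t"
proof -
  define u where "u = (SOME u. u \<in> T \<and> \<pi> (ev A d u) = \<pi> (ev A d t))"
  have u: "u \<in> T \<and> \<pi> (ev A d u) = \<pi> (ev A d t)" unfolding u_def by (rule someI) (use assms in simp)
  then have "ev A d u = ev A d t" using coll_inj assms unfolding H_def by blast
  moreover have "ev A d u = ev A d t \<longleftrightarrow> ev A \<sigma> u = ev A \<sigma> t"
    using indisc_increasing[OF d_increasing d_K \<sigma>, of "\<lambda>k. if k = 0 then u else t" "Equal 0 1"] u assms by simp
  ultimately show ?thesis unfolding embed_def u_def by blast
qed

lemma embed_d: "\<beta> \<in> K \<Longrightarrow> embed \<sigma> (\<pi> (d \<beta>)) = \<sigma> \<beta>"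
  using embed_term[of "Var \<beta>"] by simp

text \<open>\<open>M\<close> is isomorphic to \<open>H\<close>, \<open>H\<close> is elementary in
  the level at \<kappa>, and there indiscernibility replaces d by \<sigma> in the
  parameters.\<close>

lemma embed_elementary: "elementary_embedding (embed \<sigma>) M A"
  unfolding elementary_embedding_def
proof (intro conjI allI impI)
  show "embed \<sigma> \<in> M \<rightarrow> A"
  proof
    fix m assume "m \<in> M"
    then obtain t where t: "t \<in> T" "m = \<pi> (ev A d t)" unfolding H_def by blast
    have "ev A \<sigma> t \<in> A" by (rule ev_in[OF A_nonempty]) (use t(1) \<sigma>(2) D_K K_A in auto)
    then show "embed \<sigma> m \<in> A" using embed_term[OF t(1)] t(2) by simp
  qed
  fix \<phi> and s :: "nat \<Rightarrow> 'v" assume "range s \<subseteq> M"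
  then have "\<forall>k. \<exists>t. t \<in> T \<and> s k = \<pi> (ev A d t)" unfolding H_def by blast
  then obtain ts where ts: "\<And>k. ts k \<in> T" "\<And>k. s k = \<pi> (ev A d (ts k))" by metis
  have rng: "range (\<lambda>k. ev A d (ts k)) \<subseteq> H" unfolding H_def using ts(1) by blast
  have "sat M s \<phi> \<longleftrightarrow> sat M (\<pi> \<circ> (\<lambda>k. ev A d (ts k))) \<phi>"
    by (rule arg_cong[where f = "\<lambda>s. sat M s \<phi>"]) (simp add: ts(2) fun_eq_iff)
  also have "\<dots> \<longleftrightarrow> sat H (\<lambda>k. ev A d (ts k)) \<phi>"
    by (rule sat_iso[OF inj_on_coll coll_mem_iff rng])
  also have "\<dots> \<longleftrightarrow> sat A (\<lambda>k. ev A d (ts k)) \<phi>" by (rule sat_H[OF rng])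
  also have "\<dots> \<longleftrightarrow> sat A (\<lambda>k. ev A \<sigma> (ts k)) \<phi>"
    by (rule indisc_increasing[OF d_increasing d_K \<sigma>]) (use ts(1) in blast)
  also have "(\<lambda>k. ev A \<sigma> (ts k)) = embed \<sigma> \<circ> s" using embed_term ts by (simp add: fun_eq_iff)
  finally show "sat M s \<phi> \<longleftrightarrow> sat A (embed \<sigma> \<circ> s) \<phi>" .
qed

end

end

section \<open>Finite ordinals are not critical\<close>

text \<open>A finite c is empty or the successor of some b, which is fixed because it is below c.
  Either description is first-order, so elementarity would fix c as well.\<close>

lemma crit_infinite:
  assumes j: "elementary_embedding j M A" and c: "is_crit j M c"
    and M: "\<And>x. x \<in> M \<Longrightarrow> elts x \<subseteq> M" and A: "\<And>x. x \<in> A \<Longrightarrow> elts x \<subseteq> A"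
  shows "infinite (elts c)"
proof
  assume fin: "finite (elts c)"
  have cM: "c \<in> M" and Oc: "Ord c" and moved: "j c \<noteq> c"
    and least: "\<And>\<beta>. \<beta> \<in> M \<Longrightarrow> Ord \<beta> \<Longrightarrow> j \<beta> \<noteq> \<beta> \<Longrightarrow> \<beta> = c \<or> c \<in> elts \<beta>"
    using c unfolding is_crit_def by auto
  have jA: "j x \<in> A" if "x \<in> M" for x using j that unfolding elementary_embedding_def by blast
  have elem: "sat M s \<phi> \<longleftrightarrow> sat A (j \<circ> s) \<phi>" if "range s \<subseteq> M" for s \<phi>
    using j that unfolding elementary_embedding_def by blast
  have "elts (j c) = elts c"
  proof (cases "elts c = {}")
    case True
    have rng: "range (\<lambda>_::nat. c) \<subseteq> M" using cM by auto
    have "sat M (\<lambda>_. c) (All_fm 1 (Neg (Mem 1 0)))" using True by simp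
    then have "sat A (j \<circ> (\<lambda>_. c)) (All_fm 1 (Neg (Mem 1 0)))" using elem[OF rng] by blast
    then have "\<forall>y\<in>A. y \<notin> elts (j c)" by simp
    then show ?thesis using True A[OF jA[OF cM]] by blast
  next
    case False
    then obtain b where b: "b \<in> elts c" "elts c = insert b (elts b)"
      using finite_Ord_predecessor[OF Oc fin] by blast
    have bM: "b \<in> M" using M[OF cM] b(1) by blast
    have jb: "j b = b" using least[OF bM Ord_in_Ord[OF Oc b(1)]] b(1) mem_asym by auto
    define s where "s k = (if k = 0 then c else b)" for k :: nat
    let ?succ = "All_fm 2 (Iff_fm (Mem 2 0) (Or_fm (Mem 2 1) (Equal 2 1)))"
    have "range s \<subseteq> M" using cM bM by (auto simp: s_def)
    moreover have "sat M s ?succ" using b(2) by (auto simp: s_def)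
    ultimately have "sat A (j \<circ> s) ?succ" using elem by blast
    then have "\<forall>y\<in>A. y \<in> elts (j c) \<longleftrightarrow> y \<in> elts b \<or> y = b" by (simp add: s_def jb)
    moreover have "b \<in> A" using jA[OF bM] jb by simp
    ultimately show ?thesis using A[OF jA[OF cM]] A[of b] unfolding b(2) by blast
  qed
  then show False using moved extensionality by blast
qed

section \<open>Embeddings with a prescribed set of fixed cardinals\<close>

theorem theorem3p1:
  fixes \<kappa> :: "'v::set_universe"
  assumes "measurable_cardinal \<kappa>"
  shows "\<exists>M. transitive M \<and> elts M \<subseteq> Vlevel \<kappa> \<and> elts M \<approx> elts \<kappa> \<and>
           (\<forall>\<delta>. \<delta> \<in> elts \<kappa> \<or> \<delta> = \<kappa> \<longrightarrow>
             (\<exists>j c. elementary_embedding j (elts M) (Vlevel \<kappa>) \<and> is_crit j (elts M) c \<and>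
                has_ordertype
                  {\<mu> \<in> elts M. card_in (elts M) \<mu> \<and> c \<in> elts \<mu> \<and> j \<mu> = \<mu>} \<delta>))"
proof -
  obtain W where "normal_ultrafilter \<kappa> W" using measurable_cardinal_normal[OF assms] by blast
  then obtain D where "indiscernibles \<kappa> W D" using normal_ultrafilter.indiscernibles_ex by blast
  then interpret indiscernibles \<kappa> W D .
  obtain m where m: "elts m = M" using collapsed_set_ex by blast
  \<comment> \<open>This x, named \<open>nx\<close> \<beta> below, is the next indiscernible after d
    \<beta>.\<close>
  have "\<exists>x. x \<in> D \<and> d \<beta> \<in> elts x \<and> (\<forall>y\<in>D. d \<beta> \<in> elts y \<longrightarrow> y = x \<or> x \<in> elts y)" if \<beta>: "\<beta> \<in> K" for \<beta>
  proof -
    obtain z where z: "z \<in> D" "d \<beta> \<in> elts z"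
      using W_nonempty[OF W_Int[OF D_W W_tail[OF enum_in_kappa[OF D_W \<beta>]]]] by blast
    obtain x where "x \<in> D \<and> d \<beta> \<in> elts x"
      "\<And>y. y \<in> K \<Longrightarrow> y \<in> D \<and> d \<beta> \<in> elts y \<Longrightarrow> y = x \<or> x \<in> elts y"
      using Ord_least[OF Ord_kappa D_K[OF z(1)], of "\<lambda>x. x \<in> D \<and> d \<beta> \<in> elts x"] z by metis
    then show ?thesis using D_K by blast
  qed
  then obtain nx where nx: "\<And>\<beta>. \<beta> \<in> K \<Longrightarrow> nx \<beta> \<in> D" "\<And>\<beta>. \<beta> \<in> K \<Longrightarrow> d \<beta> \<in> elts (nx \<beta>)"
    "\<And>\<beta> y. \<beta> \<in> K \<Longrightarrow> y \<in> D \<Longrightarrow> d \<beta> \<in> elts y \<Longrightarrow> y = nx \<beta> \<or> nx \<beta> \<in> elts y" by metis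
  \<comment> \<open>Closure under \<open>nx\<close>, which holds almost everywhere by diagonal
    intersection, forces d \<alpha> = \<alpha> and allows an increasing \<sigma> to fix \<alpha>
    while moving smaller points up.\<close>
  define D' where "D' = D \<inter> {\<alpha> \<in> K. \<forall>\<beta>\<in>elts \<alpha>. nx \<beta> \<in> elts \<alpha>}"
  have D'_W: "D' \<in> W" unfolding D'_def by (rule W_Int[OF D_W W_diagonal[OF W_tail[OF D_K[OF nx(1)]]]])
  have D': "\<alpha> \<in> D" "\<alpha> \<in> K" "\<And>\<beta>. \<beta> \<in> elts \<alpha> \<Longrightarrow> nx \<beta> \<in> elts \<alpha>" if "\<alpha> \<in> D'" for \<alpha>
    using that unfolding D'_def by blast+
  have D'_fix: "d \<alpha> = \<alpha>" if \<alpha>: "\<alpha> \<in> D'" for \<alpha>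
  proof -
    obtain \<gamma> where \<gamma>: "\<gamma> \<in> K" "d \<gamma> = \<alpha>" using enum_onto[OF D_W D'(1)[OF \<alpha>]] by blast
    \<comment> \<open>Otherwise closure would give \<open>nx\<close> \<gamma> < \<alpha> = d
      \<gamma> < \<open>nx\<close> \<gamma>.\<close>
    have "\<gamma> \<notin> elts \<alpha>"
      using D'(3)[OF \<alpha>, of \<gamma>] nx(2)[OF \<gamma>(1)] \<gamma>(2) mem_asym by blast
    then have "d \<gamma> = \<gamma>" using enum_ge[OF D_W \<gamma>(1)] \<gamma>(2) by simp
    then show ?thesis using \<gamma>(2) by simp
  qed
  have main: "\<exists>j c. elementary_embedding j M A \<and> is_crit j M c \<and>
      has_ordertype {\<mu> \<in> M. card_in M \<mu> \<and> c \<in> elts \<mu> \<and> j \<mu> = \<mu>} \<delta>"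
    if "\<delta> \<in> K \<or> \<delta> = \<kappa>" for \<delta>
  proof -
    have \<delta>K: "elts \<delta> \<subseteq> K" using that below_kappa by blast
    \<comment> \<open>The first \<delta> members of \<open>D'\<close>, and all of them when \<delta>
      = \<kappa>.\<close>
    define S where "S = enum D' ` elts \<delta>"
    have SD': "\<alpha> \<in> D'" if "\<alpha> \<in> S" for \<alpha> using that enum_in[OF D'_W] \<delta>K unfolding S_def by blast
    have ot: "has_ordertype S \<delta>"
    proof -
      have inc: "increasing_on (elts \<delta>) (enum D')"
        using increasing_on_subset[OF enum_increasing[OF D'_W] \<delta>K] .
      have O: "Ord x" if "x \<in> elts \<delta>" for x using that \<delta>K Ord_in_kappa by blast
      let ?f = "the_inv_into (elts \<delta>) (enum D')"
      have inj: "inj_on (enum D') (elts \<delta>)" using increasing_on_inj[OF inc O] .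
      have "bij_betw ?f S (elts \<delta>)"
        using bij_betw_the_inv_into[of "enum D'" "elts \<delta>" S] inj unfolding bij_betw_def S_def by blast
      moreover have "x \<in> elts y \<longleftrightarrow> ?f x \<in> elts (?f y)" if "x \<in> S" "y \<in> S" for x y
        using that increasing_on_iff[OF inc O] the_inv_into_f_f[OF inj] unfolding S_def by auto
      ultimately show ?thesis unfolding has_ordertype_def by blast
    qed
    \<comment> \<open>\<open>nx\<close> \<beta> lies above d \<beta>, which is at least \<beta>; so
      below \<kappa> exactly the members of \<open>S\<close> are fixed by \<sigma>.\<close>
    define \<sigma> where "\<sigma> \<beta> = (if \<beta> \<in> S then \<beta> else nx \<beta>)" for \<beta>
    have \<sigma>D: "\<sigma> ` K \<subseteq> D" using SD' D'(1) nx(1) unfolding \<sigma>_def by auto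
    have \<sigma>_inc: "increasing_on K \<sigma>"
      unfolding increasing_on_def
    proof (intro ballI impI)
      fix \<beta> \<gamma> assume bg: "\<beta> \<in> K" "\<gamma> \<in> K" "\<beta> \<in> elts \<gamma>"
      have dd: "d \<beta> \<in> elts (d \<gamma>)" using enum_less[OF D_W bg(2,3)] .
      show "\<sigma> \<beta> \<in> elts (\<sigma> \<gamma>)"
      proof (cases "\<gamma> \<in> S")
        case True
        then show ?thesis using bg(3) D'(3)[OF SD'[OF True]] unfolding \<sigma>_def by auto
      next
        case False
        \<comment> \<open>A fixed \<beta> equals d \<beta>, and otherwise \<open>nx\<close> \<beta>
          is the least member of \<open>D\<close> above d \<beta>. Both are at most d \<gamma>,
          which is below \<open>nx\<close> \<gamma>.\<close>
        have "\<sigma> \<beta> = d \<gamma> \<or> \<sigma> \<beta> \<in> elts (d \<gamma>)"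
        proof (cases "\<beta> \<in> S")
          case True
          then show ?thesis using dd D'_fix[OF SD'[OF True]] unfolding \<sigma>_def by simp
        next
          case False
          then show ?thesis using nx(3)[OF bg(1) d_D[OF bg(2)] dd] unfolding \<sigma>_def by auto
        qed
        then show ?thesis
          using nx(2)[OF bg(2)] Ord_trans[OF D_Ord[OF nx(1)[OF bg(2)]]] False unfolding \<sigma>_def by auto
      qed
    qed
    define j where "j = embed \<sigma>"
    have elem: "elementary_embedding j M A" unfolding j_def by (rule embed_elementary[OF \<sigma>_inc \<sigma>D])
    have jd: "j (\<pi> (d \<beta>)) = \<sigma> \<beta>" if "\<beta> \<in> K" for \<beta> unfolding j_def by (rule embed_d[OF \<sigma>_inc \<sigma>D that])
    have MK: "x \<in> K" if "x \<in> M" "Ord x" for x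
      using Ord_in_Vlevel[OF that(2) Ord_kappa] M_subset that(1) by blast
    \<comment> \<open>For the empty ordinal e, \<pi> (d e) is countable while j sends it to an
      uncountable member of \<open>D\<close>. So j moves some ordinal, and its critical point is
      countable.\<close>
    obtain e where e: "e \<in> K" "elts e = {}"
    proof -
      obtain x where "x \<in> K" using W_nonempty[OF W_top] by blast
      then obtain e where "e \<in> K" "\<And>z. z \<in> K \<Longrightarrow> z = e \<or> e \<in> elts z"
        using Ord_least[OF Ord_kappa, of x "\<lambda>_. True"] by metis
      then show thesis using that[of e] below_kappa mem_asym mem_not_refl by (metis all_not_in_conv)
    qed
    have p: "\<pi> (d e) \<in> M" "Ord (\<pi> (d e))" using d_H Ord_coll_d e(1) by blast+
    have p_count: "countable (elts (\<pi> (d e)))"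
      using elts_coll_d_lepoll[OF e(1)] e(2) countable_lepoll by (metis Un_empty_left)
    have p_moved: "j (\<pi> (d e)) \<noteq> \<pi> (d e)"
    proof
      assume "j (\<pi> (d e)) = \<pi> (d e)"
      then have "\<pi> (d e) \<in> D" using jd[OF e(1)] \<sigma>D e(1) by auto
      then show False using D_uncountable p_count by blast
    qed
    obtain c where c: "c \<in> M" "Ord c" "j c \<noteq> c"
      and c_least: "\<And>z. z \<in> M \<Longrightarrow> Ord z \<Longrightarrow> j z \<noteq> z \<Longrightarrow> z = c \<or> c \<in> elts z"
    proof -
      obtain c where "c \<in> M \<and> Ord c \<and> j c \<noteq> c"
        "\<And>z. z \<in> K \<Longrightarrow> z \<in> M \<and> Ord z \<and> j z \<noteq> z \<Longrightarrow> z = c \<or> c \<in> elts z"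
        using Ord_least[OF Ord_kappa MK[OF p], of "\<lambda>z. z \<in> M \<and> Ord z \<and> j z \<noteq> z"] p p_moved by metis
      then show thesis using that MK by blast
    qed
    have crit: "is_crit j M c" unfolding is_crit_def using c c_least by blast
    have c_count: "countable (elts c)"
    proof -
      have "elts c \<subseteq> elts (\<pi> (d e))" using c_least[OF p p_moved] Ord_trans[OF p(2)] by blast
      then show ?thesis using p_count countable_subset by blast
    qed
    have "{\<mu> \<in> M. card_in M \<mu> \<and> c \<in> elts \<mu> \<and> j \<mu> = \<mu>} = S"
    proof (intro equalityI subsetI)
      fix \<alpha> assume \<alpha>: "\<alpha> \<in> S"
      then have \<alpha>': "\<alpha> \<in> D" "\<alpha> \<in> K" "d \<alpha> = \<alpha>" using SD' D' D'_fix by blast+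
      have C: "Card \<alpha>" "uncountable (elts \<alpha>)" using D_Card D_uncountable \<alpha>'(1) by blast+
      have pa: "\<pi> (d \<alpha>) = \<alpha>" by (rule coll_d_Card[OF \<alpha>'(2) C])
      have "\<alpha> \<in> M" using d_H[OF \<alpha>'(2)] pa by (metis imageI)
      moreover have "card_in M \<alpha>" by (rule Card_imp_card_in[OF M_trans \<open>\<alpha> \<in> M\<close> C(1)])
      moreover have "c \<in> elts \<alpha>" by (rule countable_Ord_memI[OF c(2) Card_imp_Ord[OF C(1)] c_count C(2)])
      moreover have "j \<alpha> = \<alpha>" using jd[OF \<alpha>'(2)] pa \<alpha> by (simp add: \<sigma>_def)
      ultimately show "\<alpha> \<in> {\<mu> \<in> M. card_in M \<mu> \<and> c \<in> elts \<mu> \<and> j \<mu> = \<mu>}" by blast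
    next
      fix \<mu> assume "\<mu> \<in> {\<mu> \<in> M. card_in M \<mu> \<and> c \<in> elts \<mu> \<and> j \<mu> = \<mu>}"
      then have \<mu>: "\<mu> \<in> M" "card_in M \<mu>" "c \<in> elts \<mu>" "j \<mu> = \<mu>" by auto
      \<comment> \<open>\<open>M\<close> may miss bijections, but since j fixes \<mu>, elementarity
        makes \<mu> a cardinal of the level at \<kappa>, where cardinals are true ones.\<close>
      have "card_in A \<mu>" using elementary_card_in[OF elem \<mu>(1)] \<mu>(2,4) by simp
      then have C: "Card \<mu>" using card_in_level_imp_Card M_subset \<mu>(1) by blast
      have \<mu>K: "\<mu> \<in> K" using MK[OF \<mu>(1) Card_imp_Ord[OF C]] .
      have unc: "uncountable (elts \<mu>)"
      proof
        \<comment> \<open>A countable \<mu> would be equipotent with its infinite member c.\<close>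
        assume cnt: "countable (elts \<mu>)"
        have inf: "infinite (elts c)" by (rule crit_infinite[OF elem crit M_trans A_trans])
        have "elts c \<subseteq> elts \<mu>" using \<mu>(3) Ord_trans[OF Card_imp_Ord[OF C]] by blast
        then have inf\<mu>: "infinite (elts \<mu>)" using inf finite_subset by blast
        have "elts c \<approx> (UNIV :: nat set)" "(UNIV :: nat set) \<approx> elts \<mu>"
          using inf inf\<mu> cnt c_count by (meson countableE_infinite eqpoll_def eqpoll_sym)+
        then show False using C \<mu>(3) eqpoll_trans unfolding Card_def by blast
      qed
      \<comment> \<open>As \<mu> = \<pi> (d \<mu>), the embedding acts on \<mu> as \<sigma>
        does.\<close>
      have \<sigma>\<mu>: "\<sigma> \<mu> = \<mu>" using jd[OF \<mu>K] coll_d_Card[OF \<mu>K C unc] \<mu>(4) by simp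
      show "\<mu> \<in> S"
      proof (rule ccontr)
        assume "\<mu> \<notin> S"
        then have "d \<mu> \<in> elts \<mu>" using \<sigma>\<mu> nx(2)[OF \<mu>K] unfolding \<sigma>_def by simp
        then show False using enum_ge[OF D_W \<mu>K] mem_asym[of "d \<mu>" \<mu>] by auto
      qed
    qed
    then show ?thesis using elem crit ot by auto
  qed
  have "transitive m" unfolding transitive_def m using M_trans by blast
  then show ?thesis
    using m M_subset M_eqpoll main by (intro exI[of _ m]) simp
qed

end
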